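(* Let $F\in\mathbb{C}^{m\times n}$ and $G\in\mathbb{C}^{n\times m}$ be matrices such that $GF$ is not Frobenius-singular. For $\boldsymbol{t}=(t_1,\dots,t_{2n})\in\mathbb{C}^{2n}_*$ put $$S(\boldsymbol{t})=\Big(\frac{g_if_j}{t_i-t_{n+j}}\Big)_{i,j=1}^n,\qquad \Gamma=\{\boldsymbol{t}\in\mathbb{C}^{2n}_*:\det S(\boldsymbol{t})=0\},$$ where $g_i$ is the $i$-th row of $G$ and $f_j$ is the $j$-th column of $F$. For $\boldsymbol{t}\in\mathbb{C}^{2n}_*\setminus\Gamma$ define $$Q_k(\boldsymbol{t})=-FS^{-1}(\boldsymbol{t})\,I_{[k]}\,S(\boldsymbol{t})\,(t_kI-A_{\mathcal Z}(\boldsymbol{t}))^{-1}S^{-1}(\boldsymbol{t})G,\qquad 1\le k\le n,$$ $$Q_k(\boldsymbol{t})=-FS^{-1}(\boldsymbol{t})\,(t_kI-A_{\mathcal P}(\boldsymbol{t}))^{-1}S(\boldsymbol{t})\,I_{[k-n]}\,S^{-1}(\boldsymbol{t})G,\qquad n+1\le k\le 2n,$$ and $V(\boldsymbol{t})=-FS^{-1}(\boldsymbol{t})G$. Then: (i) the rational functions $Q_1,\dots,Q_{2n}$ satisfy, on $\mathbb{C}^{2n}_*\setminus\Gamma$, the Schlesinger system $$\frac{\partial Q_k}{\partial t_\ell}=\frac{[Q_\ell,Q_k]}{t_\ell-t_k}\quad(k\ne\ell),\qquad \frac{\partial Q_k}{\partial t_k}=\sum_{\ell\ne k}\frac{[Q_\ell,Q_k]}{t_k-t_\ell};$$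 (ii) $Q_k(\boldsymbol{t})=\dfrac{\partial V(\boldsymbol{t})}{\partial t_k}$ for $k=1,\dots,2n$; (iii) the function $R(z,\boldsymbol{t})=I+FS^{-1}(\boldsymbol{t})(zI-A_{\mathcal P}(\boldsymbol{t}))^{-1}G$ is a solution of the Fuchsian system $\dfrac{\partial R(z,\boldsymbol{t})}{\partial z}=\Big(\sum_{k=1}^{2n}\dfrac{Q_k(\boldsymbol{t})}{z-t_k}\Big)R(z,\boldsymbol{t})$ with $R(z,\boldsymbol{t})=I-\dfrac{V(\boldsymbol{t})}{z}+o(|z|^{-1})$ as $z\to\infty$; (iv) $\tau(\boldsymbol{t})=\det S(\boldsymbol{t})$ is the tau-function of this solution, i.e. for any two points $\boldsymbol{t}_0,\boldsymbol{t}\in\mathbb{C}^{2n}_*\setminus\Gamma$ and any piecewise smooth path $\gamma$ in $\mathbb{C}^{2n}_*\setminus\Gamma$ from $\boldsymbol{t}_0$ to $\boldsymbol{t}$, $$\det S(\boldsymbol{t})=\det S(\boldsymbol{t}_0)\cdot\exp\Big\{\int_\gamma\sum_{\substack{1\le i,j\le 2n\\ j\ne i}}\frac{\operatorname{trace}\big(\frac{\partial V}{\partial t_i}\cdot\frac{\partial V}{\partial t_j}\big)}{t_i-t_j}\,dt_i\Big\}.$$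
   Context: $\mathbb{C}^{2n}_*$ is the set of $\boldsymbol{t}\in\mathbb{C}^{2n}$ with pairwise distinct coordinates; $[A,B]=AB-BA$. $A_{\mathcal P}(\boldsymbol{t})=\mathrm{diag}(t_1,\dots,t_n)$, $A_{\mathcal Z}(\boldsymbol{t})=\mathrm{diag}(t_{n+1},\dots,t_{2n})$, and $I_{[k]}=\mathrm{diag}(\delta_{1,k},\dots,\delta_{n,k})$ ($n\times n$). A matrix $M=(m_{i,j})\in\mathbb{C}^{n\times n}$ is Frobenius-singular if for some $1\le\ell\le n$ there exist indices $1\le\alpha_1<\dots<\alpha_\ell\le n$ and $1\le\beta_1<\dots<\beta_{n-\ell+1}\le n$ such that $m_{\alpha_i,\beta_j}=0$ for all $1\le i\le\ell$, $1\le j\le n-\ell+1$. (If $GF$ is not Frobenius-singular, then $\det S(\boldsymbol{t})\not\equiv0$.) *)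

theory Defs
  imports "HOL-Analysis.Analysis" "HOL-Library.Landau_Symbols"
begin

text \<open>
  The \<open>2n\<close> variables are indexed by \<open>'n + 'n\<close>: the coordinates \<open>t\<^sub>1, \<dots>, t\<^sub>n\<close> are
  \<open>t $ Inl i\<close>, and \<open>t\<^bsub>n+1\<^esub>, \<dots>, t\<^bsub>2n\<^esub>\<close> are \<open>t $ Inr j\<close>.
\<close>

definition distinct_coords :: "(complex ^ 'd) set" where
  "distinct_coords = {t. \<forall>i j. i \<noteq> j \<longrightarrow> t $ i \<noteq> t $ j}"

text \<open>The index sets \<open>A\<close> and \<open>B\<close> stand for the increasing tuples of row and column indices.\<close>

definition frobenius_singular :: "complex ^ 'n ^ 'n \<Rightarrow> bool" where
  "frobenius_singular M \<longleftrightarrow>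
     (\<exists>l. 1 \<le> l \<and> l \<le> CARD('n) \<and>
        (\<exists>(A :: 'n set) (B :: 'n set).
           card A = l \<and> card B = CARD('n) - l + 1 \<and> (\<forall>i\<in>A. \<forall>j\<in>B. M $ i $ j = 0)))"

definition diag :: "complex ^ 'n \<Rightarrow> complex ^ 'n ^ 'n" where
  "diag v = (\<chi> i j. if i = j then v $ i else 0)"

definition mscale :: "complex \<Rightarrow> complex ^ 'b ^ 'a \<Rightarrow> complex ^ 'b ^ 'a"  (infixr \<open>*\<^sub>M\<close> 75) where
  "c *\<^sub>M M = (\<chi> i j. c * M $ i $ j)"

definition commutator :: "complex ^ 'n ^ 'n \<Rightarrow> complex ^ 'n ^ 'n \<Rightarrow> complex ^ 'n ^ 'n" where
  "commutator A B = A ** B - B ** A"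

definition A_P :: "complex ^ ('n + 'n) \<Rightarrow> complex ^ 'n ^ 'n" where
  "A_P t = diag (\<chi> i. t $ Inl i)"

definition A_Z :: "complex ^ ('n + 'n) \<Rightarrow> complex ^ 'n ^ 'n" where
  "A_Z t = diag (\<chi> i. t $ Inr i)"

definition I_unit :: "'n \<Rightarrow> complex ^ 'n ^ 'n" where
  "I_unit k = diag (\<chi> i. if i = k then 1 else 0)"

definition S_mat :: "complex ^ 'n ^ 'm \<Rightarrow> complex ^ 'm ^ 'n \<Rightarrow> complex ^ ('n + 'n) \<Rightarrow> complex ^ 'n ^ 'n" where
  "S_mat F G t =
     (\<chi> i j. (\<Sum>p\<in>UNIV. row i G $ p * column j F $ p) / (t $ Inl i - t $ Inr j))"

definition Gamma_set :: "complex ^ 'n ^ 'm \<Rightarrow> complex ^ 'm ^ 'n \<Rightarrow> (complex ^ ('n + 'n)) set" where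
  "Gamma_set F G = {t \<in> distinct_coords. det (S_mat F G t) = 0}"

text \<open>Below, \<open>mat c\<close> is the scalar matrix \<open>cI\<close>.\<close>

definition Q_mat ::
    "complex ^ 'n ^ 'm \<Rightarrow> complex ^ 'm ^ 'n \<Rightarrow> 'n + 'n \<Rightarrow> complex ^ ('n + 'n) \<Rightarrow> complex ^ 'm ^ 'm" where
  "Q_mat F G k t =
     (let S = S_mat F G t; Si = matrix_inv S in
      case k of
        Inl k' \<Rightarrow> - (F ** Si ** I_unit k' ** S ** matrix_inv (mat (t $ k) - A_Z t) ** Si ** G)
      | Inr k' \<Rightarrow> - (F ** Si ** matrix_inv (mat (t $ k) - A_P t) ** S ** I_unit k' ** Si ** G))"

definition V_mat :: "complex ^ 'n ^ 'm \<Rightarrow> complex ^ 'm ^ 'n \<Rightarrow> complex ^ ('n + 'n) \<Rightarrow> complex ^ 'm ^ 'm" where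
  "V_mat F G t = - (F ** matrix_inv (S_mat F G t) ** G)"

definition R_mat ::
    "complex ^ 'n ^ 'm \<Rightarrow> complex ^ 'm ^ 'n \<Rightarrow> complex \<Rightarrow> complex ^ ('n + 'n) \<Rightarrow> complex ^ 'm ^ 'm" where
  "R_mat F G z t =
     mat 1 + F ** matrix_inv (S_mat F G t) ** matrix_inv (mat z - A_P t) ** G"

text \<open>
  Complex derivatives of matrix-valued functions are entrywise, since \<open>complex ^ 'b ^ 'a\<close> is
  only a real normed space in the library.
\<close>

definition has_matrix_derivative ::
    "(complex \<Rightarrow> complex ^ 'b ^ 'a) \<Rightarrow> complex ^ 'b ^ 'a \<Rightarrow> complex \<Rightarrow> bool" where
  "has_matrix_derivative f D z \<longleftrightarrow>
     (\<forall>i j. ((\<lambda>w. f w $ i $ j) has_field_derivative D $ i $ j) (at z))"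

definition subst_coord :: "complex ^ 'd \<Rightarrow> 'd \<Rightarrow> complex \<Rightarrow> complex ^ 'd" where
  "subst_coord t k w = (\<chi> l. if l = k then w else t $ l)"

definition has_partial_derivative ::
    "(complex ^ 'd \<Rightarrow> complex ^ 'b ^ 'a) \<Rightarrow> complex ^ 'b ^ 'a \<Rightarrow> 'd \<Rightarrow> complex ^ 'd \<Rightarrow> bool" where
  "has_partial_derivative f D k t \<longleftrightarrow>
     has_matrix_derivative (\<lambda>w. f (subst_coord t k w)) D (t $ k)"

definition partial_deriv ::
    "'d \<Rightarrow> (complex ^ 'd \<Rightarrow> complex ^ 'b ^ 'a) \<Rightarrow> complex ^ 'd \<Rightarrow> complex ^ 'b ^ 'a" where
  "partial_deriv k f t = (\<chi> i j. deriv (\<lambda>w. f (subst_coord t k w) $ i $ j) (t $ k))"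

inductive complex_polynomial_function :: "(complex ^ 'd \<Rightarrow> complex) \<Rightarrow> bool" where
  coord: "complex_polynomial_function (\<lambda>t. t $ i)"
| const: "complex_polynomial_function (\<lambda>t. c)"
| add: "complex_polynomial_function p \<Longrightarrow> complex_polynomial_function q \<Longrightarrow>
    complex_polynomial_function (\<lambda>t. p t + q t)"
| mult: "complex_polynomial_function p \<Longrightarrow> complex_polynomial_function q \<Longrightarrow>
    complex_polynomial_function (\<lambda>t. p t * q t)"

definition rational_function_on :: "(complex ^ 'd) set \<Rightarrow> (complex ^ 'd \<Rightarrow> complex) \<Rightarrow> bool" where
  "rational_function_on D f \<longleftrightarrow>
     (\<exists>p q. complex_polynomial_function p \<and> complex_polynomial_function q \<and>
        (\<forall>t\<in>D. q t \<noteq> 0 \<and> f t = p t / q t))"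

text \<open>
  \<open>J\<close> is the integral along \<open>\<gamma>\<close> of the 1-form whose coefficient at \<open>dt\<^sub>i\<close> is \<open>\<omega> i\<close>
  (compare \<open>has_contour_integral\<close>).
\<close>

definition has_path_integral ::
    "('d \<Rightarrow> complex ^ 'd \<Rightarrow> complex) \<Rightarrow> complex \<Rightarrow> (real \<Rightarrow> complex ^ 'd) \<Rightarrow> bool" where
  "has_path_integral \<omega> J \<gamma> \<longleftrightarrow>
     ((\<lambda>s. \<Sum>i\<in>UNIV. \<omega> i (\<gamma> s) * vector_derivative \<gamma> (at s within {0..1}) $ i)
        has_integral J) {0..1}"

end

theory Submission
  imports Defs "HOL-Complex_Analysis.Winding_Numbers"
begin

text \<open>
  Write \<open>S\<^sub>k\<close> and \<open>S\<^sub>k\<^sub>l\<close> for the first and second partial derivatives of the Cauchy-type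
  matrix \<open>S\<close>, and \<open>T = S\<^sup>-\<^sup>1\<close>. Both derivatives are explicit, because the entry \<open>(i, j)\<close> of \<open>S\<close>
  depends on \<open>t\<close> only through the difference \<open>t\<^sub>i - t\<^bsub>n+j\<^esub>\<close>. The definition of \<open>Q\<^sub>k\<close> amounts to
  \<open>Q\<^sub>k = F T S\<^sub>k T G\<close> (lemma \<open>Q_mat_eq\<close>), which is the derivative of \<open>V = - F T G\<close>; this is (ii).

  Everything else rests on the displacement equations
    \<open>A\<^sub>P S - S A\<^sub>Z = G F\<close>,  \<open>A\<^sub>P S\<^sub>k = t\<^sub>k S\<^sub>k + S \<partial>\<^sub>k A\<^sub>Z\<close>,  \<open>S\<^sub>k A\<^sub>Z = t\<^sub>k S\<^sub>k + (\<partial>\<^sub>k A\<^sub>P) S\<close>.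
  The first one replaces the factor \<open>G F\<close> inside \<open>Q\<^sub>l Q\<^sub>k = F T S\<^sub>l T (G F) T S\<^sub>k T G\<close>, and the other
  two then move \<open>A\<^sub>P\<close> and \<open>A\<^sub>Z\<close> out of the product (\<open>Q_mat_mult\<close>). Antisymmetrizing in \<open>k, l\<close> gives
  \<open>[Q\<^sub>l, Q\<^sub>k] = (t\<^sub>l - t\<^sub>k) \<partial>\<^sub>k \<partial>\<^sub>l V\<close> (\<open>commutator_Q_mat\<close>), the off-diagonal Schlesinger equations.
  The diagonal ones follow since \<open>V\<close> is invariant under simultaneous translation of all
  coordinates, so that \<open>\<Sum>\<^sub>l \<partial>\<^sub>k \<partial>\<^sub>l V = 0\<close> (\<open>ddV_sum\<close>).

  For (iii), partial fractions give \<open>\<Sum>\<^sub>k S\<^sub>k / (z - t\<^sub>k) = - (z - A\<^sub>P)\<^sup>-\<^sup>1 S (z - A\<^sub>Z)\<^sup>-\<^sup>1\<close>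
  (\<open>sum_dS_poles\<close>), and the Sylvester equation gives
  \<open>(z - A\<^sub>Z)\<^sup>-\<^sup>1 T G R(z) = T (z - A\<^sub>P)\<^sup>-\<^sup>1 G\<close>; the product of the two is
  \<open>- F T (z - A\<^sub>P)\<^sup>-\<^sup>2 G = \<partial>R/\<partial>z\<close>.

  For (iv), taking traces in the product formula yields
  \<open>trace (Q\<^sub>k Q\<^sub>l) = (t\<^sub>k - t\<^sub>l)\<^sup>2 \<partial>\<^sub>k \<partial>\<^sub>l log det S\<close> (\<open>trace_Q_mat_mult\<close>, with the second derivative
  written out by Jacobi's formula). Hence the coefficient of \<open>dt\<^sub>k\<close> in the 1-form is
  \<open>\<Sum>\<^sub>l (t\<^sub>k - t\<^sub>l) \<partial>\<^sub>l \<partial>\<^sub>k log det S\<close>. Since \<open>\<partial>\<^sub>k log det S\<close> is translation invariant and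
  homogeneous of degree \<open>-1\<close>, Euler's relation turns this sum into \<open>\<partial>\<^sub>k log det S\<close> itself
  (\<open>sum_trace_Q_mat\<close>). The 1-form is thus \<open>d log det S\<close>, and integrating the logarithmic
  derivative of the nonvanishing function \<open>det S\<close> along the path gives the stated formula.
\<close>

section \<open>Matrix algebra\<close>

lemma matrix_add_rdistrib: "(A + B) ** C = A ** C + B ** (C :: 'a::semiring_1 ^ 'p ^ 'n)"
  by (simp add: vec_eq_iff matrix_matrix_mult_def distrib_right sum.distrib)

lemma matrix_diff_ldistrib: "A ** (B - C) = A ** B - A ** (C :: 'a::ring_1 ^ 'p ^ 'n)"
  by (simp add: vec_eq_iff matrix_matrix_mult_def right_diff_distrib sum_subtractf)

lemma matrix_diff_rdistrib: "(A - B) ** C = A ** C - B ** (C :: 'a::ring_1 ^ 'p ^ 'n)"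
  by (simp add: vec_eq_iff matrix_matrix_mult_def left_diff_distrib sum_subtractf)

lemma matrix_minus_left: "(- A) ** B = - (A ** (B :: 'a::ring_1 ^ 'p ^ 'n))"
  by (simp add: vec_eq_iff matrix_matrix_mult_def sum_negf)

lemma matrix_minus_right: "A ** (- B) = - (A ** (B :: 'a::ring_1 ^ 'p ^ 'n))"
  by (simp add: vec_eq_iff matrix_matrix_mult_def sum_negf)

lemma matrix_sum_left: "(\<Sum>k\<in>K. A k) ** B = (\<Sum>k\<in>K. A k ** (B :: 'a::semiring_1 ^ 'p ^ 'n))"
  by (induction K rule: infinite_finite_induct) (simp_all add: matrix_add_rdistrib)

lemma matrix_sum_right: "A ** (\<Sum>k\<in>K. B k) = (\<Sum>k\<in>K. A ** (B k :: 'a::semiring_1 ^ 'p ^ 'n))"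
  by (induction K rule: infinite_finite_induct) (simp_all add: matrix_add_ldistrib)

lemma mscale_nth [simp]: "(c *\<^sub>M A) $ i $ j = c * A $ i $ j"
  by (simp add: mscale_def)

lemma mscale_mult_left: "(c *\<^sub>M A) ** B = c *\<^sub>M (A ** B)"
  by (simp add: vec_eq_iff matrix_matrix_mult_def sum_distrib_left mult.assoc)

lemma mscale_mult_right: "A ** (c *\<^sub>M B) = c *\<^sub>M (A ** B)"
  by (simp add: vec_eq_iff matrix_matrix_mult_def sum_distrib_left mult.left_commute)

lemmas matrix_algebra =
  matrix_add_ldistrib matrix_add_rdistrib matrix_diff_ldistrib matrix_diff_rdistrib
  matrix_minus_left matrix_minus_right mscale_mult_left mscale_mult_right
  matrix_mul_assoc [symmetric]

lemma trace_mscale: "trace (c *\<^sub>M A) = c * trace A"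
  by (simp add: trace_def sum_distrib_left)

lemma trace_sum: "trace (\<Sum>k\<in>K. A k :: 'a::comm_semiring_1 ^ 'n ^ 'n) = (\<Sum>k\<in>K. trace (A k))"
  by (induction K rule: infinite_finite_induct) (simp_all add: trace_add, simp_all add: trace_def)

lemma norm_mscale: "norm (c *\<^sub>M A) = cmod c * norm A"
  by (simp add: norm_vec_def norm_mult L2_set_right_distrib mscale_def)

lemma diag_mult_nth: "(diag v ** A) $ i $ j = v $ i * A $ i $ j"
  by (simp add: diag_def matrix_matrix_mult_def if_distrib if_distribR cong: if_cong)

lemma mult_diag_nth: "(A ** diag v) $ i $ j = A $ i $ j * v $ j"
  by (simp add: diag_def matrix_matrix_mult_def if_distrib if_distribR cong: if_cong)

lemma matrix_inv_inverse:
  fixes A :: "'a::field ^ 'n ^ 'n"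
  assumes "det A \<noteq> 0"
  shows "A ** matrix_inv A = mat 1" "matrix_inv A ** A = mat 1"
proof -
  have "invertible A" using assms by (simp add: invertible_det_nz)
  then have "A ** matrix_inv A = mat 1 \<and> matrix_inv A ** A = mat 1"
    unfolding invertible_def matrix_inv_def by (rule someI_ex)
  then show "A ** matrix_inv A = mat 1" "matrix_inv A ** A = mat 1" by auto
qed

lemma matrix_inv_eqI:
  fixes A :: "'a::field ^ 'n ^ 'n"
  assumes "A ** B = mat 1"
  shows "matrix_inv A = B"
proof -
  have "det A * det B = 1" using assms by (metis det_I det_mul)
  then have "matrix_inv A ** A = mat 1" by (intro matrix_inv_inverse) auto
  then show ?thesis using assms by (metis matrix_mul_assoc matrix_mul_lid matrix_mul_rid)
qed

lemma matrix_inv_scalar_minus_diag: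
  assumes "\<And>i. z \<noteq> v $ i"
  shows "matrix_inv (mat z - diag v) = diag (\<chi> i. 1 / (z - v $ i))"
proof (rule matrix_inv_eqI)
  have eq: "mat z - diag v = diag (\<chi> i. z - v $ i)"
    by (simp add: vec_eq_iff diag_def mat_def)
  show "(mat z - diag v) ** diag (\<chi> i. 1 / (z - v $ i)) = mat 1"
    unfolding eq vec_eq_iff diag_mult_nth using assms by (simp add: diag_def mat_def)
qed

text \<open>
  Cramer's rule makes the entries of the inverse explicit quotients of polynomials in the entries
  of the matrix; rationality and continuity of \<open>S\<^sup>-\<^sup>1\<close> are both read off from it.
\<close>

lemma matrix_inv_nth:
  fixes A :: "'a::field ^ 'n ^ 'n"
  assumes "det A \<noteq> 0"
  shows "matrix_inv A $ i $ j =
    det (\<chi> r c. if c = i then (if r = j then 1 else 0) else A $ r $ c) / det A"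
proof -
  have "A *v column j (matrix_inv A) = column j (mat 1)"
    unfolding matrix_inv_inverse(1)[OF assms, symmetric]
    by (simp add: vec_eq_iff column_def matrix_vector_mult_def matrix_matrix_mult_def)
  then have "column j (matrix_inv A) =
    (\<chi> k. det (\<chi> r c. if c = k then column j (mat 1) $ r else A $ r $ c) / det A)"
    by (simp add: cramer[OF assms])
  then have "column j (matrix_inv A) $ i =
    det (\<chi> r c. if c = i then column j (mat 1) $ r else A $ r $ c) / det A"
    by simp
  then show ?thesis
    by (simp add: column_def mat_def if_distrib cong: if_cong)
qed

section \<open>Calculus of matrix-valued functions\<close>

lemma tendsto_det:
  fixes M :: "'b \<Rightarrow> 'a::real_normed_field ^ 'n ^ 'n"
  assumes "\<And>i j. ((\<lambda>x. M x $ i $ j) \<longlongrightarrow> L $ i $ j) Fl"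
  shows "((\<lambda>x. det (M x)) \<longlongrightarrow> det L) Fl"
  unfolding det_def by (intro tendsto_intros assms)

lemma tendsto_matrix_inv:
  fixes M :: "'b \<Rightarrow> 'a::real_normed_field ^ 'n ^ 'n"
  assumes M: "\<And>i j. ((\<lambda>x. M x $ i $ j) \<longlongrightarrow> L $ i $ j) Fl" and L: "det L \<noteq> 0"
  shows "((\<lambda>x. matrix_inv (M x) $ i $ j) \<longlongrightarrow> matrix_inv L $ i $ j) Fl"
proof -
  have *: "((\<lambda>x. det (M x)) \<longlongrightarrow> det L) Fl" by (intro tendsto_det M)
  have "((\<lambda>x. det (\<chi> r c. if c = i then (if r = j then 1 else 0) else M x $ r $ c) / det (M x))
    \<longlongrightarrow> det (\<chi> r c. if c = i then (if r = j then 1 else 0) else L $ r $ c) / det L) Fl"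
    by (intro tendsto_divide tendsto_det * L) (simp add: M)
  also have "det (\<chi> r c. if c = i then (if r = j then 1 else 0) else L $ r $ c) / det L
      = matrix_inv L $ i $ j"
    by (simp add: matrix_inv_nth L)
  finally show ?thesis
    by (rule Lim_transform_eventually)
      (use tendsto_imp_eventually_ne[OF * L] in eventually_elim, simp add: matrix_inv_nth)
qed

lemma has_matrix_derivative_cong:
  assumes "eventually (\<lambda>w. f w = g w) (nhds z)"
  shows "has_matrix_derivative f D z \<longleftrightarrow> has_matrix_derivative g D z"
proof -
  have "\<forall>\<^sub>F w in nhds z. f w $ i $ j = g w $ i $ j" for i j
    using assms by eventually_elim simp
  then have "((\<lambda>w. f w $ i $ j) has_field_derivative D $ i $ j) (at z) \<longleftrightarrow>
        ((\<lambda>w. g w $ i $ j) has_field_derivative D $ i $ j) (at z)" for i j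
    by (intro DERIV_cong_ev refl)
  then show ?thesis by (simp add: has_matrix_derivative_def)
qed

lemma has_matrix_derivative_mult:
  assumes "has_matrix_derivative f D z" "has_matrix_derivative g E z"
  shows "has_matrix_derivative (\<lambda>w. f w ** g w) (D ** g z + f z ** E) z"
proof -
  have "((\<lambda>w. \<Sum>k\<in>UNIV. f w $ i $ k * g w $ k $ j) has_field_derivative
          (\<Sum>k\<in>UNIV. D $ i $ k * g z $ k $ j + f z $ i $ k * E $ k $ j)) (at z)" for i j
    using assms unfolding has_matrix_derivative_def
    by (intro DERIV_sum) (auto intro!: derivative_eq_intros)
  then show ?thesis
    by (simp add: has_matrix_derivative_def matrix_matrix_mult_def sum.distrib)
qed

lemma has_matrix_derivative_const: "has_matrix_derivative (\<lambda>w. C) 0 z"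
  by (simp add: has_matrix_derivative_def)

lemma has_matrix_derivative_minus:
  "has_matrix_derivative f D z \<Longrightarrow> has_matrix_derivative (\<lambda>w. - f w) (- D) z"
  by (auto simp: has_matrix_derivative_def intro!: derivative_eq_intros)

lemma has_matrix_derivative_sandwich:
  assumes "has_matrix_derivative f D z"
  shows "has_matrix_derivative (\<lambda>w. A ** f w ** B) (A ** D ** B) z"
  using has_matrix_derivative_mult[OF has_matrix_derivative_mult
      [OF has_matrix_derivative_const assms] has_matrix_derivative_const, of A B]
  by simp

text \<open>
  The resolvent identity \<open>M(w)\<^sup>-\<^sup>1 - M(z)\<^sup>-\<^sup>1 = - M(w)\<^sup>-\<^sup>1 (M(w) - M(z)) M(z)\<^sup>-\<^sup>1\<close> reduces
  differentiability of the inverse to its continuity.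
\<close>

lemma has_matrix_derivative_inv:
  fixes M :: "complex \<Rightarrow> complex ^ 'n ^ 'n"
  assumes D: "has_matrix_derivative M D z" and nz: "det (M z) \<noteq> 0"
  shows "has_matrix_derivative (\<lambda>w. matrix_inv (M w))
           (- (matrix_inv (M z) ** D ** matrix_inv (M z))) z"
proof -
  let ?T = "\<lambda>w. matrix_inv (M w)"
  have M: "((\<lambda>w. M w $ i $ j) \<longlongrightarrow> M z $ i $ j) (at z)" for i j
    using D unfolding has_matrix_derivative_def by (blast dest: DERIV_isCont isContD)
  have ev: "\<forall>\<^sub>F w in at z. det (M w) \<noteq> 0"
    by (rule tendsto_imp_eventually_ne[OF tendsto_det[OF M] nz])
  have quot: "((\<lambda>w. (M w $ i $ j - M z $ i $ j) / (w - z)) \<longlongrightarrow> D $ i $ j) (at z)" for i j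
    using D unfolding has_matrix_derivative_def has_field_derivative_iff by blast
  have resolvent: "?T w - ?T z = - (?T w ** (M w - M z) ** ?T z)" if "det (M w) \<noteq> 0" for w
  proof -
    have "?T w ** (M w ** ?T z) = ?T z"
      using matrix_inv_inverse(2)[OF that] by (simp add: matrix_mul_assoc)
    then show ?thesis
      using matrix_inv_inverse(1)[OF nz] by (simp add: matrix_algebra)
  qed
  have "((\<lambda>w. (?T w $ i $ j - ?T z $ i $ j) / (w - z)) \<longlongrightarrow>
        (- (?T z ** D ** ?T z)) $ i $ j) (at z)" for i j
  proof -
    have "((\<lambda>w. - (\<Sum>l\<in>UNIV. (\<Sum>k\<in>UNIV. ?T w $ i $ k * ((M w $ k $ l - M z $ k $ l) / (w - z)))
              * ?T z $ l $ j))
          \<longlongrightarrow> - (\<Sum>l\<in>UNIV. (\<Sum>k\<in>UNIV. ?T z $ i $ k * D $ k $ l) * ?T z $ l $ j)) (at z)"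
      by (intro tendsto_intros quot tendsto_matrix_inv[OF M nz])
    then have "((\<lambda>w. - (\<Sum>l\<in>UNIV. (\<Sum>k\<in>UNIV. ?T w $ i $ k * ((M w $ k $ l - M z $ k $ l) / (w - z)))
              * ?T z $ l $ j))
          \<longlongrightarrow> (- (?T z ** D ** ?T z)) $ i $ j) (at z)"
      by (simp add: matrix_matrix_mult_def)
    then show ?thesis
    proof (rule Lim_transform_eventually)
      show "\<forall>\<^sub>F w in at z. - (\<Sum>l\<in>UNIV. (\<Sum>k\<in>UNIV. ?T w $ i $ k *
                ((M w $ k $ l - M z $ k $ l) / (w - z))) * ?T z $ l $ j) =
              (?T w $ i $ j - ?T z $ i $ j) / (w - z)"
        using ev
      proof eventually_elim
        case (elim w)
        have "?T w $ i $ j - ?T z $ i $ j = (- (?T w ** (M w - M z) ** ?T z)) $ i $ j"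
          using resolvent[OF elim] by (metis vector_minus_component)
        then show ?case
          by (simp add: matrix_matrix_mult_def sum_divide_distrib sum_distrib_right mult.assoc)
      qed
    qed
  qed
  then show ?thesis by (simp add: has_matrix_derivative_def has_field_derivative_iff)
qed

text \<open>The linear part of \<open>det (1 + H)\<close> is \<open>trace H\<close>, read off from the Leibniz expansion.\<close>

lemma has_derivative_det_at_identity:
  fixes M :: "'b::real_normed_vector \<Rightarrow> 'a::real_normed_field ^ 'n ^ 'n"
  assumes D: "\<And>i j. ((\<lambda>x. M x $ i $ j) has_derivative D i j) (at a within X)"
    and id: "M a = mat 1"
  shows "((\<lambda>x. det (M x)) has_derivative (\<lambda>h. \<Sum>i\<in>UNIV. D i i h)) (at a within X)"
proof -
  let ?P = "{p. p permutes (UNIV :: 'n set)}"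
  let ?t = "\<lambda>p h. of_int (sign p) * (\<Sum>i\<in>UNIV. D i (p i) h * (\<Prod>j\<in>UNIV - {i}. M a $ j $ p j))"
  have "((\<lambda>x. det (M x)) has_derivative (\<lambda>h. \<Sum>p\<in>?P. ?t p h)) (at a within X)"
    unfolding det_def
    by (intro has_derivative_sum has_derivative_mult_right has_derivative_prod D)
  moreover have "(\<Sum>p\<in>?P. ?t p h) = (\<Sum>i\<in>UNIV. D i i h)" for h
  proof -
    \<comment> \<open>A permutation other than the identity moves at least two indices, so that after one factor
        has been differentiated an off-diagonal entry of the identity matrix remains.\<close>
    have "?t p h = 0" if "p \<in> ?P - {id}" for p
    proof -
      have "(\<Prod>j\<in>UNIV - {i}. M a $ j $ p j) = 0" for i
      proof -
        have inj: "inj p" using that permutes_inj by auto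
        have "p \<noteq> id" using that by blast
        then obtain j where j: "p j \<noteq> j" by (metis eq_id_iff)
        have "\<exists>j. j \<noteq> i \<and> p j \<noteq> j"
        proof (cases "j = i")
          case True
          then have "p j \<noteq> i \<and> p (p j) \<noteq> p j" using j inj by (auto dest: injD)
          then show ?thesis by blast
        qed (use j in blast)
        then obtain k where "k \<noteq> i" "p k \<noteq> k" by blast
        then show ?thesis by (intro prod_zero bexI[of _ k]) (auto simp: id mat_def)
      qed
      then show ?thesis by (simp only: mult_zero_right sum.neutral_const)
    qed
    then have "(\<Sum>p\<in>?P. ?t p h) = ?t id h"
      by (subst sum.remove[of _ id]) (auto simp: permutes_id)
    also have "\<dots> = (\<Sum>i\<in>UNIV. D i i h)"
      by (simp add: id mat_def sign_id)
    finally show ?thesis .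
  qed
  ultimately show ?thesis by simp
qed

text \<open>Jacobi's formula; multiplying by the inverse of the value reduces it to the identity matrix.\<close>

lemma has_vector_derivative_det:
  fixes M :: "real \<Rightarrow> 'a::real_normed_field ^ 'n ^ 'n"
  assumes D: "\<And>i j. ((\<lambda>s. M s $ i $ j) has_vector_derivative D $ i $ j) (at a within X)"
    and nz: "det (M a) \<noteq> 0"
  shows "((\<lambda>s. det (M s)) has_vector_derivative
           det (M a) * trace (matrix_inv (M a) ** D)) (at a within X)"
proof -
  let ?T = "matrix_inv (M a)"
  have eq: "det (M a) * det (?T ** M s) = det (M s)" for s
    using matrix_inv_inverse(1)[OF nz] by (metis det_mul matrix_mul_assoc matrix_mul_lid)
  have "((\<lambda>s. (?T ** M s) $ i $ j) has_derivative (\<lambda>h. h *\<^sub>R (?T ** D) $ i $ j)) (at a within X)"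
    for i j
  proof -
    have "((\<lambda>s. \<Sum>k\<in>UNIV. ?T $ i $ k * M s $ k $ j) has_vector_derivative
        (\<Sum>k\<in>UNIV. ?T $ i $ k * D $ k $ j)) (at a within X)"
      by (intro has_vector_derivative_sum has_vector_derivative_mult_right D)
    then show ?thesis by (simp add: has_vector_derivative_def matrix_matrix_mult_def)
  qed
  from has_derivative_det_at_identity[OF this] matrix_inv_inverse(2)[OF nz]
  have "((\<lambda>s. det (?T ** M s)) has_vector_derivative trace (?T ** D)) (at a within X)"
    by (simp add: has_vector_derivative_def trace_def scaleR_sum_right)
  then have "((\<lambda>s. det (M a) * det (?T ** M s)) has_vector_derivative
      det (M a) * trace (?T ** D)) (at a within X)"
    by (rule has_vector_derivative_mult_right)
  then show ?thesis by (simp add: eq)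
qed

section \<open>The Cauchy-type matrix and its derivatives\<close>

text \<open>The partial derivative of \<open>t\<^sub>i - t\<^bsub>n+j\<^esub>\<close> with respect to \<open>t\<^sub>k\<close>.\<close>

definition incidence :: "'n \<Rightarrow> 'n \<Rightarrow> 'n + 'n \<Rightarrow> complex" where
  "incidence i j k = of_bool (k = Inl i) - of_bool (k = Inr j)"

definition dS :: "complex ^ 'n ^ 'm \<Rightarrow> complex ^ 'm ^ 'n \<Rightarrow> 'n + 'n \<Rightarrow>
    complex ^ ('n + 'n) \<Rightarrow> complex ^ 'n ^ 'n" where
  "dS F G k t = (\<chi> i j. - ((G ** F) $ i $ j * incidence i j k / (t $ Inl i - t $ Inr j)\<^sup>2))"

definition ddS :: "complex ^ 'n ^ 'm \<Rightarrow> complex ^ 'm ^ 'n \<Rightarrow> 'n + 'n \<Rightarrow> 'n + 'n \<Rightarrow>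
    complex ^ ('n + 'n) \<Rightarrow> complex ^ 'n ^ 'n" where
  "ddS F G k l t = (\<chi> i j. 2 * (G ** F) $ i $ j * incidence i j k * incidence i j l
     / (t $ Inl i - t $ Inr j) ^ 3)"

definition dA_P :: "'n + 'n \<Rightarrow> complex ^ 'n ^ 'n" where
  "dA_P k = diag (\<chi> i. of_bool (k = Inl i))"

definition dA_Z :: "'n + 'n \<Rightarrow> complex ^ 'n ^ 'n" where
  "dA_Z k = diag (\<chi> j. of_bool (k = Inr j))"

lemma S_mat_nth: "S_mat F G t $ i $ j = (G ** F) $ i $ j / (t $ Inl i - t $ Inr j)"
  by (simp add: S_mat_def matrix_matrix_mult_def row_def column_def)

lemma distinct_coords_denominator:
  "t \<in> distinct_coords \<Longrightarrow> t $ Inl i - t $ Inr j \<noteq> 0"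
  by (auto simp: distinct_coords_def)

lemma sum_incidence:
  fixes f :: "'n::finite + 'n \<Rightarrow> complex"
  shows "(\<Sum>k\<in>UNIV. incidence i j k * f k) = f (Inl i) - f (Inr j)"
  by (simp add: incidence_def left_diff_distrib sum_subtractf of_bool_def if_distrib[of "\<lambda>x. x * _"]
      cong: if_cong)

lemma subst_coord_nth: "subst_coord t k w $ l = (if l = k then w else t $ l)"
  by (simp add: subst_coord_def)

lemma subst_coord_self [simp]: "subst_coord t k (t $ k) = t"
  by (simp add: subst_coord_def vec_eq_iff)

lemma denominator_derivative:
  "((\<lambda>w. subst_coord t k w $ Inl i - subst_coord t k w $ Inr j)
     has_field_derivative incidence i j k) (at w)"
proof -
  have "((\<lambda>w. subst_coord t k w $ l) has_field_derivative of_bool (k = l)) (at w)" for l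
    by (cases "k = l") (auto simp: subst_coord_nth)
  then show ?thesis
    unfolding incidence_def by (intro DERIV_diff)
qed

lemma eventually_subst_coord_distinct:
  assumes "t \<in> distinct_coords"
  shows "\<forall>\<^sub>F w in nhds (t $ k). subst_coord t k w \<in> distinct_coords"
proof -
  have "\<forall>\<^sub>F w in nhds (t $ k). subst_coord t k w $ i \<noteq> subst_coord t k w $ j" if "i \<noteq> j" for i j
  proof -
    have ne: "t $ i \<noteq> t $ j" using assms that by (auto simp: distinct_coords_def)
    have "((\<lambda>w. subst_coord t k w $ l) \<longlongrightarrow> t $ l) (nhds (t $ k))" for l
      by (cases "l = k") (auto simp: subst_coord_nth intro: tendsto_intros filterlim_ident)
    then have "((\<lambda>w. subst_coord t k w $ i - subst_coord t k w $ j) \<longlongrightarrow> t $ i - t $ j) (nhds (t $ k))"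
      by (intro tendsto_diff)
    from tendsto_imp_eventually_ne[OF this, of 0] ne show ?thesis by simp
  qed
  then have "\<forall>\<^sub>F w in nhds (t $ k). \<forall>i j. i \<noteq> j \<longrightarrow> subst_coord t k w $ i \<noteq> subst_coord t k w $ j"
    by (intro eventually_all_finite) (simp add: eventually_mono)
  then show ?thesis by (simp add: distinct_coords_def)
qed

lemma has_partial_derivative_S_mat:
  assumes "t \<in> distinct_coords"
  shows "has_partial_derivative (S_mat F G) (dS F G k t) k t"
proof -
  have "((\<lambda>w. c / d w) has_field_derivative - (c * e / (d z)\<^sup>2)) (at z)"
    if "(d has_field_derivative e) (at z)" "d z \<noteq> 0" for d :: "complex \<Rightarrow> complex" and c e z
    using that by (auto intro!: derivative_eq_intros simp: power2_eq_square)
  from this[OF denominator_derivative[of t k _ _ "t $ k"]] show ?thesis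
    using distinct_coords_denominator[OF assms]
    by (simp add: has_partial_derivative_def has_matrix_derivative_def S_mat_nth dS_def)
qed

lemma has_partial_derivative_dS:
  assumes "t \<in> distinct_coords"
  shows "has_partial_derivative (dS F G k) (ddS F G k l t) l t"
proof -
  have "((\<lambda>w. - (c * b / (d w)\<^sup>2)) has_field_derivative 2 * c * b * e / d z ^ 3) (at z)"
    if "(d has_field_derivative e) (at z)" "d z \<noteq> 0" for d :: "complex \<Rightarrow> complex" and b c e z
    using that by (auto intro!: derivative_eq_intros simp: power2_eq_square power3_eq_cube mult_ac)
  from this[OF denominator_derivative[of t l _ _ "t $ l"]] show ?thesis
    using distinct_coords_denominator[OF assms]
    by (simp add: has_partial_derivative_def has_matrix_derivative_def dS_def ddS_def)
qed

text \<open>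
  Since \<open>S\<close> depends on differences of coordinates only and is homogeneous of degree \<open>-1\<close>, the
  operator \<open>\<Sum>\<^sub>k \<partial>\<^sub>k\<close> annihilates \<open>S\<close> and its derivatives, and \<open>\<Sum>\<^sub>k t\<^sub>k \<partial>\<^sub>k\<close> multiplies \<open>S\<close> by \<open>-1\<close> and
  its first derivatives by \<open>-2\<close>.
\<close>

lemma dS_sum:
  fixes F :: "complex ^ 'n ^ 'm" and G :: "complex ^ 'm ^ 'n"
  shows "(\<Sum>k\<in>UNIV. dS F G k t) = 0"
proof -
  have "(\<Sum>k\<in>UNIV. incidence i j k) = 0" for i j :: 'n
    using sum_incidence[of i j "\<lambda>_. 1"] by simp
  then show ?thesis
    by (simp add: vec_eq_iff sum_component dS_def sum_negf
        flip: sum_divide_distrib sum_distrib_left)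
qed

lemma ddS_sum:
  fixes F :: "complex ^ 'n ^ 'm" and G :: "complex ^ 'm ^ 'n"
  shows "(\<Sum>l\<in>UNIV. ddS F G k l t) = 0"
proof -
  have "(\<Sum>k\<in>UNIV. incidence i j k) = 0" for i j :: 'n
    using sum_incidence[of i j "\<lambda>_. 1"] by simp
  then show ?thesis
    by (simp add: vec_eq_iff sum_component ddS_def flip: sum_divide_distrib sum_distrib_left)
qed

lemma dS_euler:
  assumes "t \<in> distinct_coords"
  shows "(\<Sum>k\<in>UNIV. (t $ k) *\<^sub>M dS F G k t) = - S_mat F G t"
proof -
  have "(\<Sum>k\<in>UNIV. (t $ k) *\<^sub>M dS F G k t) $ i $ j = (- S_mat F G t) $ i $ j" for i j
  proof -
    have "(\<Sum>k\<in>UNIV. (t $ k) *\<^sub>M dS F G k t) $ i $ j =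
      (\<Sum>k\<in>UNIV. incidence i j k * t $ k) * (- ((G ** F) $ i $ j / (t $ Inl i - t $ Inr j)\<^sup>2))"
      unfolding sum_component sum_distrib_right
      by (intro sum.cong) (simp_all add: dS_def mult_ac)
    also have "\<dots> = (- S_mat F G t) $ i $ j"
      using distinct_coords_denominator[OF assms, of i j]
      by (simp add: sum_incidence S_mat_nth power2_eq_square)
    finally show ?thesis .
  qed
  then show ?thesis by (simp only: vec_eq_iff) blast
qed

lemma ddS_euler:
  assumes "t \<in> distinct_coords"
  shows "(\<Sum>l\<in>UNIV. (t $ l) *\<^sub>M ddS F G k l t) = (- 2) *\<^sub>M dS F G k t"
proof -
  have "(\<Sum>l\<in>UNIV. (t $ l) *\<^sub>M ddS F G k l t) $ i $ j = ((- 2) *\<^sub>M dS F G k t) $ i $ j" for i j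
  proof -
    have "(\<Sum>l\<in>UNIV. (t $ l) *\<^sub>M ddS F G k l t) $ i $ j =
      (\<Sum>l\<in>UNIV. incidence i j l * t $ l) *
        (2 * (G ** F) $ i $ j * incidence i j k / (t $ Inl i - t $ Inr j) ^ 3)"
      unfolding sum_component sum_distrib_right
      by (intro sum.cong) (simp_all add: ddS_def mult_ac)
    also have "\<dots> = ((- 2) *\<^sub>M dS F G k t) $ i $ j"
      using distinct_coords_denominator[OF assms, of i j]
      by (simp add: sum_incidence dS_def power2_eq_square power3_eq_cube)
    finally show ?thesis .
  qed
  then show ?thesis by (simp only: vec_eq_iff) blast
qed

text \<open>
  The displacement equations. Differentiating \<open>sylvester\<close> shows that
  \<open>A\<^sub>P S\<^sub>k - S \<partial>\<^sub>k A\<^sub>Z = S\<^sub>k A\<^sub>Z - (\<partial>\<^sub>k A\<^sub>P) S\<close>. Both sides equal \<open>t\<^sub>k S\<^sub>k\<close> because \<open>S\<^sub>k\<close> is supported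
  either in a row on which \<open>A\<^sub>P\<close> acts as \<open>t\<^sub>k\<close>, or in a column on which \<open>A\<^sub>Z\<close> does.
\<close>

lemma sylvester:
  assumes "t \<in> distinct_coords"
  shows "A_P t ** S_mat F G t - S_mat F G t ** A_Z t = G ** F"
  using distinct_coords_denominator[OF assms]
  by (simp add: vec_eq_iff A_P_def A_Z_def diag_mult_nth mult_diag_nth S_mat_nth divide_simps)
    (simp add: algebra_simps)

lemma A_P_dS:
  assumes "t \<in> distinct_coords"
  shows "A_P t ** dS F G k t = (t $ k) *\<^sub>M dS F G k t + S_mat F G t ** dA_Z k"
  using distinct_coords_denominator[OF assms]
  by (cases k) (auto simp: vec_eq_iff A_P_def dA_Z_def diag_mult_nth mult_diag_nth S_mat_nth dS_def
      incidence_def power2_eq_square divide_simps, simp_all add: algebra_simps)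

lemma dS_A_Z:
  assumes "t \<in> distinct_coords"
  shows "dS F G k t ** A_Z t = (t $ k) *\<^sub>M dS F G k t + dA_P k ** S_mat F G t"
  using distinct_coords_denominator[OF assms]
  by (cases k) (auto simp: vec_eq_iff A_Z_def dA_P_def diag_mult_nth mult_diag_nth S_mat_nth dS_def
      incidence_def power2_eq_square divide_simps, simp_all add: algebra_simps)

text \<open>
  Only the entry in the row of one index and the column of the other can be nonzero: \<open>k\<close> and \<open>l\<close>
  interact only if one is a pole and the other a zero. The same holds in the next lemma, where
  \<open>k \<noteq> l\<close> is essential.
\<close>

lemma dS_commutator:
  assumes "t \<in> distinct_coords"
  shows "(dS F G l t ** dA_Z k - dA_P l ** dS F G k t) -
         (dS F G k t ** dA_Z l - dA_P k ** dS F G l t) = (t $ l - t $ k) *\<^sub>M ddS F G k l t"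
  using distinct_coords_denominator[OF assms]
  by (cases k; cases l) (auto simp: vec_eq_iff dA_Z_def dA_P_def diag_mult_nth mult_diag_nth dS_def
      ddS_def incidence_def power2_eq_square power3_eq_cube divide_simps, simp_all add: algebra_simps)

lemma dS_trace_identity:
  assumes "t \<in> distinct_coords" "k \<noteq> l"
  shows "A_P t ** (dS F G l t ** dA_Z k - dA_P l ** dS F G k t)
       - (dS F G l t ** dA_Z k - dA_P l ** dS F G k t) ** A_Z t
       + (t $ k - t $ l) *\<^sub>M (dS F G k t ** dA_Z l - dA_P k ** dS F G l t)
       = (t $ k - t $ l)\<^sup>2 *\<^sub>M ddS F G k l t"
  using distinct_coords_denominator[OF assms(1)] assms(2)
  by (cases k; cases l) (auto simp: vec_eq_iff dA_Z_def dA_P_def A_P_def A_Z_def diag_mult_nth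
      mult_diag_nth dS_def ddS_def incidence_def power2_eq_square power3_eq_cube divide_simps,
      simp_all add: algebra_simps)

section \<open>Derivatives of V and the Schlesinger system\<close>

abbreviation S_inv :: "complex ^ 'n ^ 'm \<Rightarrow> complex ^ 'm ^ 'n \<Rightarrow> complex ^ ('n + 'n) \<Rightarrow> complex ^ 'n ^ 'n"
  where "S_inv F G t \<equiv> matrix_inv (S_mat F G t)"

text \<open>
  The second derivative \<open>\<partial>\<^sub>k \<partial>\<^sub>l V\<close>, by the product rule and \<open>\<partial>\<^sub>k T = - T S\<^sub>k T\<close>; see
  \<open>has_partial_derivative_Q_mat\<close>.
\<close>

definition ddV :: "complex ^ 'n ^ 'm \<Rightarrow> complex ^ 'm ^ 'n \<Rightarrow> 'n + 'n \<Rightarrow> 'n + 'n \<Rightarrow>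
    complex ^ ('n + 'n) \<Rightarrow> complex ^ 'm ^ 'm" where
  "ddV F G k l t = F ** (S_inv F G t ** (ddS F G k l t
      - dS F G l t ** S_inv F G t ** dS F G k t
      - dS F G k t ** S_inv F G t ** dS F G l t) ** S_inv F G t) ** G"

text \<open>What is left of \<open>S\<^sub>l T (G F) T S\<^sub>k\<close> in \<open>Q\<^sub>l Q\<^sub>k\<close> once the displacement equations have been used.\<close>

definition Q_mult_core :: "complex ^ 'n ^ 'm \<Rightarrow> complex ^ 'm ^ 'n \<Rightarrow> complex ^ ('n + 'n) \<Rightarrow>
    'n + 'n \<Rightarrow> 'n + 'n \<Rightarrow> complex ^ 'n ^ 'n" where
  "Q_mult_core F G t l k =
     (t $ k - t $ l) *\<^sub>M (dS F G l t ** S_inv F G t ** dS F G k t)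
      + (dS F G l t ** dA_Z k - dA_P l ** dS F G k t)"

text \<open>
  The two cases of the definition merge: row \<open>i\<close> of \<open>S\<close> depends on \<open>t\<^sub>i\<close> and column \<open>j\<close> on
  \<open>t\<^bsub>n+j\<^esub>\<close>, and the products of \<open>S\<close> with a matrix unit and a resolvent are exactly
  minus the corresponding partial derivatives.
\<close>

lemma Q_mat_eq:
  assumes t: "t \<in> distinct_coords"
  shows "Q_mat F G k t = F ** (S_inv F G t ** dS F G k t ** S_inv F G t) ** G"
proof (cases k)
  case (Inl a)
  have ne: "t $ k \<noteq> (\<chi> j. t $ Inr j) $ j" for j
    using t Inl by (auto simp: distinct_coords_def)
  have "I_unit a ** S_mat F G t ** matrix_inv (mat (t $ k) - A_Z t) = - dS F G k t"
    unfolding A_Z_def matrix_inv_scalar_minus_diag[OF ne] I_unit_def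
    by (auto simp: vec_eq_iff mult_diag_nth diag_mult_nth S_mat_nth dS_def incidence_def
        power2_eq_square Inl)
  then have "F ** S_inv F G t ** (I_unit a ** S_mat F G t ** matrix_inv (mat (t $ k) - A_Z t))
      ** S_inv F G t ** G = - (F ** (S_inv F G t ** dS F G k t ** S_inv F G t) ** G)"
    by (simp add: matrix_algebra)
  then show ?thesis
    by (simp add: Q_mat_def Let_def Inl matrix_mul_assoc)
next
  case (Inr b)
  have ne: "t $ k \<noteq> (\<chi> i. t $ Inl i) $ i" for i
    using t Inr by (auto simp: distinct_coords_def)
  have "matrix_inv (mat (t $ k) - A_P t) ** S_mat F G t ** I_unit b = - dS F G k t"
    unfolding A_P_def matrix_inv_scalar_minus_diag[OF ne] I_unit_def
    using distinct_coords_denominator[OF t] ne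
    by (auto simp: vec_eq_iff mult_diag_nth diag_mult_nth S_mat_nth dS_def incidence_def
        power2_eq_square Inr divide_simps, simp_all add: algebra_simps)
  then have "F ** S_inv F G t ** (matrix_inv (mat (t $ k) - A_P t) ** S_mat F G t ** I_unit b)
      ** S_inv F G t ** G = - (F ** (S_inv F G t ** dS F G k t ** S_inv F G t) ** G)"
    by (simp add: matrix_algebra)
  then show ?thesis
    by (simp add: Q_mat_def Let_def Inr matrix_mul_assoc)
qed

lemma has_partial_derivative_S_inv:
  assumes "t \<in> distinct_coords - Gamma_set F G"
  shows "has_partial_derivative (S_inv F G)
    (- (S_inv F G t ** dS F G k t ** S_inv F G t)) k t"
proof -
  have "det (S_mat F G t) \<noteq> 0" using assms by (auto simp: Gamma_set_def)
  then show ?thesis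
    using has_matrix_derivative_inv
      [OF has_partial_derivative_S_mat[unfolded has_partial_derivative_def, of t F G k]] assms
    by (simp add: has_partial_derivative_def)
qed

lemma has_partial_derivative_V_mat:
  assumes "t \<in> distinct_coords - Gamma_set F G"
  shows "has_partial_derivative (V_mat F G) (Q_mat F G k t) k t"
proof -
  have "has_partial_derivative (\<lambda>t. - (F ** S_inv F G t ** G))
      (- (F ** (- (S_inv F G t ** dS F G k t ** S_inv F G t)) ** G)) k t"
    using has_partial_derivative_S_inv[OF assms] unfolding has_partial_derivative_def
    by (intro has_matrix_derivative_minus has_matrix_derivative_sandwich)
  then show ?thesis
    unfolding V_mat_def [abs_def]
    using assms by (simp add: Q_mat_eq matrix_minus_left matrix_minus_right)
qed

lemma has_partial_derivative_Q_mat: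
  assumes t: "t \<in> distinct_coords - Gamma_set F G"
  shows "has_partial_derivative (Q_mat F G k) (ddV F G k l t) l t"
proof -
  let ?T = "S_inv F G" and ?D = "dS F G"
  have T: "has_matrix_derivative (\<lambda>w. ?T (subst_coord t l w)) (- (?T t ** ?D l t ** ?T t)) (t $ l)"
    using has_partial_derivative_S_inv[OF t] by (simp add: has_partial_derivative_def)
  have D: "has_matrix_derivative (\<lambda>w. ?D k (subst_coord t l w)) (ddS F G k l t) (t $ l)"
    using has_partial_derivative_dS[of t F G k l] t by (simp add: has_partial_derivative_def)
  have "has_matrix_derivative (\<lambda>w. F ** (?T (subst_coord t l w) ** ?D k (subst_coord t l w)
      ** ?T (subst_coord t l w)) ** G) (ddV F G k l t) (t $ l)"
    using has_matrix_derivative_sandwich[OF has_matrix_derivative_mult[OF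
        has_matrix_derivative_mult[OF T D] T], of F G]
    by (simp add: ddV_def matrix_algebra algebra_simps)
  moreover have "\<forall>\<^sub>F w in nhds (t $ l). Q_mat F G k (subst_coord t l w) =
      F ** (?T (subst_coord t l w) ** ?D k (subst_coord t l w) ** ?T (subst_coord t l w)) ** G"
    using eventually_subst_coord_distinct[of t l] t by (auto simp: Q_mat_eq elim: eventually_mono)
  ultimately show ?thesis
    unfolding has_partial_derivative_def by (simp add: has_matrix_derivative_cong)
qed

context
  fixes F :: "complex ^ 'n ^ 'm" and G :: "complex ^ 'm ^ 'n" and t :: "complex ^ ('n + 'n)"
  assumes t: "t \<in> distinct_coords - Gamma_set F G"
begin

lemma t_distinct: "t \<in> distinct_coords"
  using t by simp

lemma S_inv_cancel:
  "S_mat F G t ** S_inv F G t = mat 1" "S_inv F G t ** S_mat F G t = mat 1"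
  "S_mat F G t ** (S_inv F G t ** X) = X" "S_inv F G t ** (S_mat F G t ** X) = X"
proof -
  have "det (S_mat F G t) \<noteq> 0" using t by (auto simp: Gamma_set_def)
  from matrix_inv_inverse[OF this]
  show "S_mat F G t ** S_inv F G t = mat 1" "S_inv F G t ** S_mat F G t = mat 1"
    "S_mat F G t ** (S_inv F G t ** X) = X" "S_inv F G t ** (S_mat F G t ** X) = X"
    by (simp_all add: matrix_mul_assoc)
qed

text \<open>The Sylvester equation \<open>A\<^sub>P S - S A\<^sub>Z = G F\<close> multiplied by \<open>T\<close> from both sides.\<close>

lemma sylvester_inverse:
  "S_inv F G t ** (G ** (F ** S_inv F G t)) = S_inv F G t ** A_P t - A_Z t ** S_inv F G t"
proof -
  have "S_inv F G t ** (G ** (F ** S_inv F G t))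
      = S_inv F G t ** (A_P t ** S_mat F G t - S_mat F G t ** A_Z t) ** S_inv F G t"
    by (simp add: sylvester t_distinct matrix_mul_assoc)
  then show ?thesis by (simp add: matrix_algebra S_inv_cancel)
qed

lemma Q_mat_mult:
  "Q_mat F G l t ** Q_mat F G k t = F ** (S_inv F G t ** Q_mult_core F G t l k ** S_inv F G t) ** G"
proof -
  let ?T = "S_inv F G t" and ?S = "S_mat F G t" and ?D = "\<lambda>k. dS F G k t"
  have "Q_mat F G l t ** Q_mat F G k t =
    F ** ?T ** (?D l ** (?T ** (G ** (F ** ?T)) ** ?D k)) ** ?T ** G"
    by (simp add: Q_mat_eq t_distinct matrix_mul_assoc)
  also have "?D l ** (?T ** (G ** (F ** ?T)) ** ?D k)
      = ?D l ** ?T ** (A_P t ** ?D k) - (?D l ** A_Z t) ** ?T ** ?D k"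
    unfolding sylvester_inverse by (simp add: matrix_algebra)
  also have "\<dots> = Q_mult_core F G t l k"
    unfolding A_P_dS[OF t_distinct] dS_A_Z[OF t_distinct]
    by (simp add: matrix_algebra S_inv_cancel Q_mult_core_def)
       (simp add: vec_eq_iff algebra_simps)
  finally show ?thesis by (simp add: matrix_mul_assoc)
qed

text \<open>
  The terms of the two products without \<open>T\<close> combine to the multiple \<open>(t\<^sub>l - t\<^sub>k) S\<^sub>k\<^sub>l\<close> that the
  second derivative of \<open>T\<close> requires, while the products with \<open>T\<close> add up because the factor
  \<open>t\<^sub>k - t\<^sub>l\<close> is antisymmetric.
\<close>

lemma commutator_Q_mat:
  "commutator (Q_mat F G l t) (Q_mat F G k t) = (t $ l - t $ k) *\<^sub>M ddV F G k l t"
proof -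
  let ?T = "S_inv F G t" and ?D = "\<lambda>k. dS F G k t"
  have "Q_mult_core F G t l k - Q_mult_core F G t k l = (t $ l - t $ k) *\<^sub>M (ddS F G k l t
      - ?D l ** ?T ** ?D k - ?D k ** ?T ** ?D l)"
    using dS_commutator[OF t_distinct, of F G l k]
    by (simp add: Q_mult_core_def vec_eq_iff algebra_simps)
  moreover have "commutator (Q_mat F G l t) (Q_mat F G k t) =
      F ** (?T ** (Q_mult_core F G t l k - Q_mult_core F G t k l) ** ?T) ** G"
    by (simp add: commutator_def Q_mat_mult matrix_algebra)
  ultimately show ?thesis
    by (simp only: mscale_mult_left mscale_mult_right ddV_def)
qed

text \<open>Invariance of \<open>V\<close> under translations \<open>t \<mapsto> t + (c, \<dots>, c)\<close>, differentiated.\<close>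

lemma ddV_sum: "(\<Sum>l\<in>UNIV. ddV F G k l t) = 0"
  by (simp add: ddV_def sum_subtractf dS_sum ddS_sum flip: matrix_sum_left matrix_sum_right)

text \<open>
  The second factor on the right is \<open>\<partial>\<^sub>k \<partial>\<^sub>l log det S\<close>. By cyclicity of the trace the
  outer factors of \<open>Q\<^sub>l Q\<^sub>k\<close> meet again in \<open>T (G F) T = T A\<^sub>P - A\<^sub>Z T\<close>, and the displacement equations
  for \<open>S\<^sub>k\<close> and \<open>S\<^sub>l\<close> produce a second factor \<open>t\<^sub>k - t\<^sub>l\<close>.
\<close>

lemma trace_Q_mat_mult:
  assumes "k \<noteq> l"
  shows "trace (Q_mat F G k t ** Q_mat F G l t) = (t $ k - t $ l)\<^sup>2 *
    trace (S_inv F G t ** (ddS F G k l t - dS F G l t ** S_inv F G t ** dS F G k t))"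
proof -
  let ?T = "S_inv F G t" and ?S = "S_mat F G t" and ?D = "\<lambda>k. dS F G k t"
  define c where "c = t $ k - t $ l"
  define X where "X = ?D l ** dA_Z k - dA_P l ** ?D k"
  define Y where "Y = ?D k ** dA_Z l - dA_P k ** ?D l"
  have "trace (Q_mat F G k t ** Q_mat F G l t) = trace (F ** (?T ** Q_mult_core F G t l k ** ?T ** G))"
    using Q_mat_mult[of l k] by (subst trace_mul_sym) (simp add: matrix_mul_assoc)
  also have "\<dots> = trace (?T ** (Q_mult_core F G t l k ** (?T ** (G ** F))))"
    by (subst trace_mul_sym) (simp add: matrix_mul_assoc)
  also have "\<dots> = trace (Q_mult_core F G t l k ** (?T ** (G ** (F ** ?T))))"
    by (subst trace_mul_sym) (simp add: matrix_mul_assoc)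
  also have "\<dots> = trace (Q_mult_core F G t l k ** ?T ** A_P t) - trace (Q_mult_core F G t l k ** A_Z t ** ?T)"
    unfolding sylvester_inverse by (simp add: matrix_algebra trace_sub)
  also have "trace (Q_mult_core F G t l k ** ?T ** A_P t) = trace (?T ** (A_P t ** Q_mult_core F G t l k))"
    by (metis trace_mul_sym matrix_mul_assoc)
  also have "trace (Q_mult_core F G t l k ** A_Z t ** ?T) = trace (?T ** (Q_mult_core F G t l k ** A_Z t))"
    by (metis trace_mul_sym)
  also have "A_P t ** Q_mult_core F G t l k = c *\<^sub>M ((A_P t ** ?D l) ** ?T ** ?D k) + A_P t ** X"
    by (simp add: Q_mult_core_def matrix_algebra c_def X_def)
  also have "\<dots> = c *\<^sub>M ((t $ l) *\<^sub>M (?D l ** ?T ** ?D k) + ?S ** dA_Z l ** ?T ** ?D k) + A_P t ** X"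
    by (simp add: A_P_dS[OF t_distinct] matrix_algebra)
  also have "Q_mult_core F G t l k ** A_Z t = c *\<^sub>M (?D l ** ?T ** (?D k ** A_Z t)) + X ** A_Z t"
    by (simp add: Q_mult_core_def matrix_algebra c_def X_def)
  also have "\<dots> = c *\<^sub>M ((t $ k) *\<^sub>M (?D l ** ?T ** ?D k) + ?D l ** ?T ** dA_P k ** ?S) + X ** A_Z t"
    by (simp add: dS_A_Z[OF t_distinct] matrix_algebra)
  also have "trace (?T ** (c *\<^sub>M ((t $ l) *\<^sub>M (?D l ** ?T ** ?D k) + ?S ** dA_Z l ** ?T ** ?D k) + A_P t ** X))
    = c * (t $ l * trace (?T ** (?D l ** ?T ** ?D k)) + trace (dA_Z l ** (?T ** ?D k)))
      + trace (?T ** (A_P t ** X))"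
    by (simp add: matrix_algebra S_inv_cancel trace_add trace_mscale)
  also have "trace (dA_Z l ** (?T ** ?D k)) = trace (?T ** (?D k ** dA_Z l))"
    by (metis trace_mul_sym matrix_mul_assoc)
  also have "trace (?T ** (c *\<^sub>M ((t $ k) *\<^sub>M (?D l ** ?T ** ?D k) + ?D l ** ?T ** dA_P k ** ?S) + X ** A_Z t))
    = c * (t $ k * trace (?T ** (?D l ** ?T ** ?D k)) + trace (?T ** (?D l ** ?T ** dA_P k ** ?S)))
      + trace (?T ** (X ** A_Z t))"
    by (simp add: matrix_algebra trace_add trace_mscale)
  also have "trace (?T ** (?D l ** ?T ** dA_P k ** ?S)) = trace (?S ** ?T ** (?D l ** ?T ** dA_P k))"
    by (metis trace_mul_sym matrix_mul_assoc)
  also have "\<dots> = trace (?T ** (dA_P k ** ?D l))"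
    by (simp add: S_inv_cancel) (metis trace_mul_sym matrix_mul_assoc)
  finally have "trace (Q_mat F G k t ** Q_mat F G l t) = - (c\<^sup>2 * trace (?T ** (?D l ** ?T ** ?D k)))
      + trace (?T ** (A_P t ** X - X ** A_Z t + c *\<^sub>M Y))"
    by (simp add: Y_def matrix_algebra trace_add trace_sub trace_mscale c_def power2_eq_square
        algebra_simps)
  also have "A_P t ** X - X ** A_Z t + c *\<^sub>M Y = c\<^sup>2 *\<^sub>M ddS F G k l t"
    using dS_trace_identity[OF t_distinct assms, of F G] by (simp add: X_def Y_def c_def)
  finally show ?thesis
    by (simp add: c_def matrix_diff_ldistrib mscale_mult_right trace_sub trace_mscale algebra_simps)
qed

text \<open>
  The right-hand side is \<open>\<partial>\<^sub>k log det S\<close>, so this identifies the 1-form of the tau-function with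
  \<open>d log det S\<close>. After cancelling one factor \<open>t\<^sub>k - t\<^sub>l\<close> the summand \<open>l = k\<close> vanishes and may be
  included; the translation relations then remove the part with \<open>t\<^sub>k\<close>, and the Euler relations
  evaluate the part with \<open>t\<^sub>l\<close>.
\<close>

lemma sum_trace_Q_mat:
  "(\<Sum>l\<in>UNIV - {k}. trace (Q_mat F G k t ** Q_mat F G l t) / (t $ k - t $ l))
     = trace (S_inv F G t ** dS F G k t)"
proof -
  let ?T = "S_inv F G t" and ?D = "\<lambda>k. dS F G k t"
  define Y where "Y l = ddS F G k l t - ?D l ** ?T ** ?D k" for l
  have "(\<Sum>l\<in>UNIV - {k}. trace (Q_mat F G k t ** Q_mat F G l t) / (t $ k - t $ l))
      = (\<Sum>l\<in>UNIV - {k}. (t $ k - t $ l) * trace (?T ** Y l))"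
  proof (intro sum.cong refl)
    fix l assume "l \<in> UNIV - {k}"
    then have "k \<noteq> l" "t $ k - t $ l \<noteq> 0"
      using t_distinct by (auto simp: distinct_coords_def)
    then show "trace (Q_mat F G k t ** Q_mat F G l t) / (t $ k - t $ l)
      = (t $ k - t $ l) * trace (?T ** Y l)"
      by (simp add: trace_Q_mat_mult Y_def power2_eq_square)
  qed
  also have "\<dots> = (\<Sum>l\<in>UNIV. (t $ k - t $ l) * trace (?T ** Y l))"
    by (simp add: sum_diff1)
  also have "\<dots> = t $ k * trace (?T ** (\<Sum>l\<in>UNIV. Y l)) - trace (?T ** (\<Sum>l\<in>UNIV. (t $ l) *\<^sub>M Y l))"
    by (simp add: matrix_sum_right trace_sum mscale_mult_right trace_mscale left_diff_distrib
        sum_subtractf sum_distrib_left)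
  also have "(\<Sum>l\<in>UNIV. Y l) = 0"
    by (simp add: Y_def sum_subtractf ddS_sum dS_sum flip: matrix_sum_left)
  also have "(\<Sum>l\<in>UNIV. (t $ l) *\<^sub>M Y l) = (\<Sum>l\<in>UNIV. (t $ l) *\<^sub>M ddS F G k l t)
      - (\<Sum>l\<in>UNIV. (t $ l) *\<^sub>M ?D l) ** ?T ** ?D k"
    unfolding matrix_sum_left mscale_mult_left
    by (simp add: Y_def vec_eq_iff sum_component right_diff_distrib sum_subtractf)
  also have "\<dots> = - ?D k"
    unfolding ddS_euler[OF t_distinct] dS_euler[OF t_distinct]
    by (simp add: matrix_minus_left S_inv_cancel matrix_mul_assoc) (simp add: vec_eq_iff)
  finally show ?thesis by (simp add: matrix_minus_right trace_def sum_negf)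
qed

end

section \<open>The Fuchsian system\<close>

definition A_P_resolvent :: "complex \<Rightarrow> complex ^ ('n + 'n) \<Rightarrow> complex ^ 'n ^ 'n" where
  "A_P_resolvent z t = diag (\<chi> i. 1 / (z - t $ Inl i))"

definition A_Z_resolvent :: "complex \<Rightarrow> complex ^ ('n + 'n) \<Rightarrow> complex ^ 'n ^ 'n" where
  "A_Z_resolvent z t = diag (\<chi> i. 1 / (z - t $ Inr i))"

lemma matrix_inv_A_P:
  "(\<And>k. z \<noteq> t $ k) \<Longrightarrow> matrix_inv (mat z - A_P t) = A_P_resolvent z t"
  by (simp add: A_P_def A_P_resolvent_def matrix_inv_scalar_minus_diag)

lemma A_P_resolvent_mult:
  assumes "\<And>k. z \<noteq> t $ k"
  shows "A_P t ** A_P_resolvent z t = z *\<^sub>M A_P_resolvent z t - mat 1"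
  using assms
  by (simp add: vec_eq_iff A_P_def diag_mult_nth A_P_resolvent_def)
     (simp add: diag_def mat_def field_simps)

lemma A_Z_resolvent_mult:
  assumes "\<And>k. z \<noteq> t $ k"
  shows "A_Z_resolvent z t ** A_Z t = z *\<^sub>M A_Z_resolvent z t - mat 1"
  using assms
  by (simp add: vec_eq_iff A_Z_def mult_diag_nth A_Z_resolvent_def)
     (simp add: diag_def mat_def field_simps)

text \<open>
  In each entry, only the poles at \<open>t\<^sub>i\<close> and \<open>t\<^bsub>n+j\<^esub>\<close> occur, with opposite residues; they combine to
  a product of two simple factors, that is, of two resolvents.
\<close>

lemma sum_dS_poles:
  assumes t: "t \<in> distinct_coords" and z: "\<And>k. z \<noteq> t $ k"
  shows "(\<Sum>k\<in>UNIV. (1 / (z - t $ k)) *\<^sub>M dS F G k t)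
    = - (A_P_resolvent z t ** S_mat F G t ** A_Z_resolvent z t)"
proof -
  have "(\<Sum>k\<in>UNIV. (1 / (z - t $ k)) *\<^sub>M dS F G k t) $ i $ j
    = (- (A_P_resolvent z t ** S_mat F G t ** A_Z_resolvent z t)) $ i $ j" for i j
  proof -
    have "(\<Sum>k\<in>UNIV. (1 / (z - t $ k)) *\<^sub>M dS F G k t) $ i $ j =
      (\<Sum>k\<in>UNIV. incidence i j k * (1 / (z - t $ k)))
        * (- ((G ** F) $ i $ j / (t $ Inl i - t $ Inr j)\<^sup>2))"
      unfolding sum_component sum_distrib_right
      by (intro sum.cong) (simp_all add: dS_def mult_ac)
    also have "\<dots> = (1 / (z - t $ Inl i) - 1 / (z - t $ Inr j))
        * (- ((G ** F) $ i $ j / (t $ Inl i - t $ Inr j)\<^sup>2))"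
      by (simp only: sum_incidence)
    also have "1 / (z - t $ Inl i) - 1 / (z - t $ Inr j)
        = (t $ Inl i - t $ Inr j) / ((z - t $ Inl i) * (z - t $ Inr j))"
      using z[of "Inl i"] z[of "Inr j"] by (simp add: field_simps)
    finally show ?thesis
      using distinct_coords_denominator[OF t, of i j]
      by (simp add: A_P_resolvent_def A_Z_resolvent_def diag_mult_nth mult_diag_nth S_mat_nth
          power2_eq_square mult_ac)
  qed
  then show ?thesis by (simp only: vec_eq_iff) blast
qed

lemma sandwich_diag_nth: "(A ** diag v ** B) $ i $ j = (\<Sum>p\<in>UNIV. A $ i $ p * v $ p * B $ p $ j)"
  by (simp add: matrix_matrix_mult_def[of "A ** diag v"] mult_diag_nth)

lemma has_matrix_derivative_R_mat:
  fixes F :: "complex ^ 'n ^ 'm" and G :: "complex ^ 'm ^ 'n"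
  assumes t: "t \<in> distinct_coords - Gamma_set F G" and z: "\<And>k. z \<noteq> t $ k"
  shows "has_matrix_derivative (\<lambda>w. R_mat F G w t)
    ((\<Sum>k\<in>UNIV. (1 / (z - t $ k)) *\<^sub>M Q_mat F G k t) ** R_mat F G z t) z"
proof -
  let ?T = "S_inv F G t" and ?r = "\<lambda>w. A_P_resolvent w t" and ?s = "A_Z_resolvent z t"
  have td: "t \<in> distinct_coords" using t by simp
  have "\<forall>\<^sub>F w in nhds z. w \<noteq> t $ k" for k
    using z[of k] t1_space_nhds by blast
  then have "\<forall>\<^sub>F w in nhds z. \<forall>k. w \<noteq> t $ k"
    by (intro eventually_all_finite)
  then have ev: "\<forall>\<^sub>F w in nhds z. R_mat F G w t = mat 1 + F ** ?T ** ?r w ** G"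
    by eventually_elim (simp add: R_mat_def matrix_inv_A_P)
  have "((\<lambda>w. \<Sum>p\<in>UNIV. (F ** ?T) $ i $ p * (1 / (w - t $ Inl p)) * G $ p $ j)
      has_field_derivative
      (\<Sum>p\<in>UNIV. (F ** ?T) $ i $ p * (- (1 / (z - t $ Inl p)\<^sup>2)) * G $ p $ j)) (at z)" for i j
    using z by (intro DERIV_sum) (auto intro!: derivative_eq_intros simp: power2_eq_square)
  then have "((\<lambda>w. (mat 1 :: complex ^ 'm ^ 'm) $ i $ j + (F ** ?T ** ?r w ** G) $ i $ j)
      has_field_derivative
      (F ** ?T ** diag (\<chi> p. - (1 / (z - t $ Inl p)\<^sup>2)) ** G) $ i $ j) (at z)" for i j
    unfolding A_P_resolvent_def sandwich_diag_nth vec_lambda_beta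
    by (rule DERIV_cong[OF DERIV_add[OF DERIV_const]]) simp
  then have D: "has_matrix_derivative (\<lambda>w. mat 1 + F ** ?T ** ?r w ** G)
      (F ** ?T ** diag (\<chi> p. - (1 / (z - t $ Inl p)\<^sup>2)) ** G) z"
    by (simp add: has_matrix_derivative_def)
  have square: "diag (\<chi> p. - (1 / (z - t $ Inl p)\<^sup>2)) = - (?r z ** ?r z)"
    unfolding A_P_resolvent_def
    by (simp add: vec_eq_iff diag_mult_nth) (simp add: diag_def power2_eq_square)
  have "(\<Sum>k\<in>UNIV. (1 / (z - t $ k)) *\<^sub>M Q_mat F G k t)
      = F ** (?T ** (\<Sum>k\<in>UNIV. (1 / (z - t $ k)) *\<^sub>M dS F G k t) ** ?T) ** G"
    by (simp add: Q_mat_eq[OF td] matrix_sum_left matrix_sum_right mscale_mult_left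
        mscale_mult_right)
  also have "\<dots> = - (F ** (?T ** (?r z ** (S_mat F G t ** (?s ** (?T ** G))))))"
    unfolding sum_dS_poles[OF td z] by (simp add: matrix_algebra)
  finally have Q: "(\<Sum>k\<in>UNIV. (1 / (z - t $ k)) *\<^sub>M Q_mat F G k t)
      = - (F ** (?T ** (?r z ** (S_mat F G t ** (?s ** (?T ** G))))))" .
  \<comment> \<open>The factor \<open>R\<close> exchanges the resolvent of \<open>A\<^sub>Z\<close> to the left of \<open>T\<close> for that of \<open>A\<^sub>P\<close> to
      its right.\<close>
  have "?s ** (?T ** (G ** (mat 1 + F ** ?T ** ?r z ** G)))
      = ?s ** ?T ** G + ?s ** (?T ** (G ** (F ** ?T))) ** ?r z ** G"
    by (simp add: matrix_algebra)
  also have "\<dots> = ?s ** ?T ** G + ?s ** ?T ** (A_P t ** ?r z) ** G - (?s ** A_Z t) ** ?T ** ?r z ** G"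
    unfolding sylvester_inverse[OF t] by (simp add: matrix_algebra)
  also have "\<dots> = ?T ** (?r z ** G)"
    unfolding A_P_resolvent_mult[OF z] A_Z_resolvent_mult[OF z]
    by (simp add: matrix_algebra)
  finally have "(\<Sum>k\<in>UNIV. (1 / (z - t $ k)) *\<^sub>M Q_mat F G k t) ** R_mat F G z t
      = - (F ** (?T ** (?r z ** (?r z ** G))))"
    unfolding Q R_mat_def using z
    by (simp add: matrix_inv_A_P matrix_minus_left S_inv_cancel[OF t] flip: matrix_mul_assoc)
  then have "(\<Sum>k\<in>UNIV. (1 / (z - t $ k)) *\<^sub>M Q_mat F G k t) ** R_mat F G z t
      = F ** ?T ** diag (\<chi> p. - (1 / (z - t $ Inl p)\<^sup>2)) ** G"
    unfolding square by (simp add: matrix_algebra)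
  then show ?thesis
    using D ev by (simp add: has_matrix_derivative_cong)
qed

text \<open>
  Expanding \<open>1 / (z - t\<^sub>p) = 1 / z + t\<^sub>p / (z (z - t\<^sub>p))\<close> exhibits the error as \<open>K(z) / z\<close> with
  \<open>K(z) \<longlonglongrightarrow> 0\<close>.
\<close>

lemma R_mat_asymptotics:
  fixes F :: "complex ^ 'n ^ 'm" and G :: "complex ^ 'm ^ 'n"
  shows "(\<lambda>z. norm (R_mat F G z t - (mat 1 - (1 / z) *\<^sub>M V_mat F G t)))
    \<in> o[at_infinity](\<lambda>z. 1 / cmod z)"
proof -
  let ?T = "S_inv F G t"
  define K where "K z = F ** ?T ** diag (\<chi> p. t $ Inl p / (z - t $ Inl p)) ** G" for z
  have ne: "\<forall>\<^sub>F z in at_infinity. z \<noteq> a" for a :: complex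
    by (rule eventually_not_equal_at_infinity)
  have "\<forall>\<^sub>F z in at_infinity. z \<noteq> 0 \<and> (\<forall>k. z \<noteq> t $ k)"
    by (intro eventually_conj eventually_all_finite ne)
  then have ev: "\<forall>\<^sub>F z in at_infinity.
      norm (K z) = norm (R_mat F G z t - (mat 1 - (1 / z) *\<^sub>M V_mat F G t)) / (1 / cmod z)"
  proof eventually_elim
    case (elim z)
    have *: "A_P_resolvent z t = (1 / z) *\<^sub>M mat 1
        + (1 / z) *\<^sub>M diag (\<chi> p. t $ Inl p / (z - t $ Inl p))"
      using elim by (auto simp: A_P_resolvent_def vec_eq_iff diag_def mat_def divide_simps)
    have "R_mat F G z t - (mat 1 - (1 / z) *\<^sub>M V_mat F G t) = (1 / z) *\<^sub>M K z"
      using elim by (simp add: R_mat_def matrix_inv_A_P * V_mat_def K_def matrix_algebra)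
        (simp add: vec_eq_iff)
    then show ?case using elim by (simp add: norm_mscale norm_divide)
  qed
  have inf: "((\<lambda>z. t $ Inl p / (z - t $ Inl p)) \<longlongrightarrow> 0) at_infinity" for p
  proof (rule tendsto_divide_0[OF tendsto_const])
    show "filterlim (\<lambda>z. z - t $ Inl p) at_infinity at_infinity"
      using tendsto_add_filterlim_at_infinity'[OF filterlim_ident tendsto_const[of "- t $ Inl p"]]
      by simp
  qed
  have "((\<lambda>z. K z $ i $ j) \<longlongrightarrow> (\<Sum>p\<in>UNIV. (F ** ?T) $ i $ p * 0 * G $ p $ j)) at_infinity" for i j
    unfolding K_def sandwich_diag_nth by (intro tendsto_intros) (simp add: inf)
  then have "(K \<longlongrightarrow> 0) at_infinity"
    by (intro vec_tendstoI) simp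
  then have "((\<lambda>z. norm (K z)) \<longlongrightarrow> 0) at_infinity"
    by (rule tendsto_norm_zero)
  then have "((\<lambda>z. norm (R_mat F G z t - (mat 1 - (1 / z) *\<^sub>M V_mat F G t)) / (1 / cmod z))
      \<longlongrightarrow> 0) at_infinity"
    using ev by (rule Lim_transform_eventually)
  then show ?thesis
    by (rule smalloI_tendsto) (use ne[of 0] in eventually_elim, simp)
qed

section \<open>The tau-function along a path\<close>

lemma partial_deriv_V_mat:
  assumes "t \<in> distinct_coords - Gamma_set F G"
  shows "partial_deriv k (V_mat F G) t = Q_mat F G k t"
  using has_partial_derivative_V_mat[OF assms, of k]
  by (simp add: partial_deriv_def has_partial_derivative_def has_matrix_derivative_def vec_eq_iff
      DERIV_imp_deriv)

lemma S_mat_along_path: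
  assumes d: "(\<gamma> has_vector_derivative v) (at s)" and t: "\<gamma> s \<in> distinct_coords"
  shows "((\<lambda>s. S_mat F G (\<gamma> s) $ i $ j) has_vector_derivative
    (\<Sum>k\<in>UNIV. (v $ k) *\<^sub>M dS F G k (\<gamma> s)) $ i $ j) (at s)"
proof -
  let ?e = "\<gamma> s $ Inl i - \<gamma> s $ Inr j"
  have "((\<lambda>s. \<gamma> s $ k) has_vector_derivative v $ k) (at s)" for k
    using bounded_linear.has_vector_derivative[OF bounded_linear_vec_nth d] .
  then have "((\<lambda>s. \<gamma> s $ Inl i - \<gamma> s $ Inr j) has_vector_derivative v $ Inl i - v $ Inr j) (at s)"
    by (intro has_vector_derivative_diff)
  moreover have "((\<lambda>x. (G ** F) $ i $ j / x) has_field_derivative - ((G ** F) $ i $ j / ?e\<^sup>2)) (at ?e)"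
    using distinct_coords_denominator[OF t]
    by (auto intro!: derivative_eq_intros simp: power2_eq_square)
  ultimately have "((\<lambda>x. (G ** F) $ i $ j / x) \<circ> (\<lambda>s. \<gamma> s $ Inl i - \<gamma> s $ Inr j) has_vector_derivative
      (v $ Inl i - v $ Inr j) * - ((G ** F) $ i $ j / ?e\<^sup>2)) (at s)"
    by (rule field_vector_diff_chain_at)
  moreover have "(v $ Inl i - v $ Inr j) * - ((G ** F) $ i $ j / ?e\<^sup>2)
      = (\<Sum>k\<in>UNIV. (v $ k) *\<^sub>M dS F G k (\<gamma> s)) $ i $ j"
    unfolding sum_component sum_incidence[of i j "($) v", symmetric] sum_distrib_right
    by (intro sum.cong) (simp_all add: dS_def)
  ultimately show ?thesis by (simp add: o_def S_mat_nth)
qed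

lemma det_S_mat_along_path:
  assumes d: "(\<gamma> has_vector_derivative v) (at s)" and t: "\<gamma> s \<in> distinct_coords - Gamma_set F G"
  shows "((\<lambda>s. det (S_mat F G (\<gamma> s))) has_vector_derivative
    det (S_mat F G (\<gamma> s)) *
      (\<Sum>k\<in>UNIV. trace (S_inv F G (\<gamma> s) ** dS F G k (\<gamma> s)) * v $ k)) (at s)"
proof -
  have "\<gamma> s \<in> distinct_coords" "det (S_mat F G (\<gamma> s)) \<noteq> 0"
    using t by (auto simp: Gamma_set_def)
  from has_vector_derivative_det[OF S_mat_along_path[OF d this(1)] this(2)]
  show ?thesis
    by (simp add: matrix_sum_right trace_sum mscale_mult_right trace_mscale mult_ac)
qed

lemma continuous_on_log_derivative:
  fixes F :: "complex ^ 'n ^ 'm" and G :: "complex ^ 'm ^ 'n"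
  assumes c: "continuous_on X \<gamma>" and t: "\<gamma> ` X \<subseteq> distinct_coords - Gamma_set F G"
  shows "continuous_on X (\<lambda>s. det (S_mat F G (\<gamma> s)))"
    "continuous_on X (\<lambda>s. trace (S_inv F G (\<gamma> s) ** dS F G k (\<gamma> s)))"
proof -
  have comp: "continuous_on X (\<lambda>s. \<gamma> s $ l)" for l
    using c by (intro continuous_intros)
  have nz: "\<forall>s\<in>X. \<gamma> s $ Inl i - \<gamma> s $ Inr j \<noteq> 0" for i j
    using t by (auto intro!: distinct_coords_denominator simp del: right_minus_eq)
  have S: "continuous_on X (\<lambda>s. S_mat F G (\<gamma> s) $ i $ j)" for i j
    unfolding S_mat_nth by (intro continuous_intros comp nz)
  then show "continuous_on X (\<lambda>s. det (S_mat F G (\<gamma> s)))"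
    unfolding continuous_on_def by (auto intro!: tendsto_det)
  have "det (S_mat F G (\<gamma> s)) \<noteq> 0" if "s \<in> X" for s
    using t that by (auto simp: Gamma_set_def)
  then have T: "continuous_on X (\<lambda>s. S_inv F G (\<gamma> s) $ i $ j)" for i j
    using S unfolding continuous_on_def by (auto intro!: tendsto_matrix_inv)
  have D: "continuous_on X (\<lambda>s. dS F G k (\<gamma> s) $ i $ j)" for i j
    using nz unfolding dS_def by simp (intro continuous_intros comp, simp)
  show "continuous_on X (\<lambda>s. trace (S_inv F G (\<gamma> s) ** dS F G k (\<gamma> s)))"
    unfolding trace_def matrix_matrix_mult_def by simp (intro continuous_on_sum continuous_on_mult T D)
qed

text \<open>
  The function \<open>\<tau> = det S\<close> along the path is a piecewise smooth curve avoiding the origin, so the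
  exponential of the integral of \<open>\<tau>' / \<tau>\<close> is the quotient of its end points; no logarithm of \<open>\<tau>\<close> has
  to be chosen. Away from the finitely many corners, \<open>\<tau>' / \<tau>\<close> is the 1-form evaluated on the path.
\<close>

lemma tau_function_along_path:
  fixes F :: "complex ^ 'n ^ 'm" and G :: "complex ^ 'm ^ 'n"
  assumes \<gamma>: "valid_path \<gamma>" and im: "path_image \<gamma> \<subseteq> distinct_coords - Gamma_set F G"
  shows "\<exists>J. has_path_integral
        (\<lambda>i u. \<Sum>j \<in> UNIV - {i}.
           trace (partial_deriv i (V_mat F G) u ** partial_deriv j (V_mat F G) u)
             / (u $ i - u $ j)) J \<gamma> \<and>
      det (S_mat F G (\<gamma> 1)) = det (S_mat F G (\<gamma> 0)) * exp J"
proof -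
  let ?\<tau> = "\<lambda>s. det (S_mat F G (\<gamma> s))"
  let ?L = "\<lambda>k u. trace (S_inv F G u ** dS F G k u)"
  let ?\<omega> = "\<lambda>i u. \<Sum>j \<in> UNIV - {i}.
           trace (partial_deriv i (V_mat F G) u ** partial_deriv j (V_mat F G) u)
             / (u $ i - u $ j)"
  have mem: "\<gamma> s \<in> distinct_coords - Gamma_set F G" if "s \<in> {0..1}" for s
    using im that unfolding path_image_def by blast
  have \<tau>_nz: "?\<tau> s \<noteq> 0" if "s \<in> {0..1}" for s
    using mem[OF that] by (auto simp: Gamma_set_def)
  have \<omega>: "?\<omega> k (\<gamma> s) = ?L k (\<gamma> s)" if "s \<in> {0..1}" for k s
    using sum_trace_Q_mat[OF mem[OF that]] by (simp add: partial_deriv_V_mat[OF mem[OF that]])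
  obtain P v where P: "finite P" and c\<gamma>: "continuous_on {0..1} \<gamma>"
    and v: "\<And>s. s \<in> {0..1} - P \<Longrightarrow> (\<gamma> has_vector_derivative v s) (at s)"
    and cv: "continuous_on ({0..1} - P) v"
    using \<gamma> unfolding valid_path_def piecewise_C1_differentiable_on_def C1_differentiable_on_def
    by blast
  have \<tau>': "(?\<tau> has_vector_derivative ?\<tau> s * (\<Sum>k\<in>UNIV. ?L k (\<gamma> s) * v s $ k)) (at s)"
    if "s \<in> {0..1} - P" for s
    using det_S_mat_along_path[OF v[OF that] mem] that by simp
  have c: "continuous_on {0..1} ?\<tau>" "continuous_on {0..1} (\<lambda>s. ?L k (\<gamma> s))" for k
    using continuous_on_log_derivative[OF c\<gamma>] mem by blast+
  have "continuous_on ({0..1} - P) (\<lambda>s. ?\<tau> s * (\<Sum>k\<in>UNIV. ?L k (\<gamma> s) * v s $ k))"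
    by (intro continuous_intros cv continuous_on_subset[OF c(1)] continuous_on_subset[OF c(2)]) auto
  with \<tau>' have "?\<tau> C1_differentiable_on {0..1} - P"
    unfolding C1_differentiable_on_def
    by (intro exI[of _ "\<lambda>s. ?\<tau> s * (\<Sum>k\<in>UNIV. ?L k (\<gamma> s) * v s $ k)"] conjI ballI)
  then have pw: "?\<tau> piecewise_C1_differentiable_on {0..1}"
    unfolding piecewise_C1_differentiable_on_def using c(1) P by (intro conjI exI[of _ P])
  let ?J = "integral {0..1} (\<lambda>s. vector_derivative ?\<tau> (at s) / (?\<tau> s - 0))"
  have "0 \<notin> ?\<tau> ` {0..1}" using \<tau>_nz by force
  note log = winding_number_exp_integral[OF pw _ this]
  have int: "((\<lambda>s. vector_derivative ?\<tau> (at s) / (?\<tau> s - 0)) has_integral ?J) {0..1}"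
    using log(1) by (simp add: integrable_integral)
  have eq: "(\<Sum>k\<in>UNIV. ?\<omega> k (\<gamma> s) * vector_derivative \<gamma> (at s within {0..1}) $ k)
      = vector_derivative ?\<tau> (at s) / (?\<tau> s - 0)" if "s \<in> {0..1} - P" for s
  proof -
    have s: "s \<in> {0..1}" using that by simp
    have "vector_derivative \<gamma> (at s within {0..1}) = v s"
      using vector_derivative_at_within_ivl[OF v[OF that], of 0 1] s by simp
    moreover have "vector_derivative ?\<tau> (at s) = ?\<tau> s * (\<Sum>k\<in>UNIV. ?L k (\<gamma> s) * v s $ k)"
      by (rule vector_derivative_at[OF \<tau>'[OF that]])
    ultimately show ?thesis using \<omega>[OF s] \<tau>_nz[OF s] by simp
  qed
  have "has_path_integral ?\<omega> ?J \<gamma>"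
    unfolding has_path_integral_def by (rule has_integral_spike_finite[OF P eq int])
  moreover have "?\<tau> 1 = ?\<tau> 0 * exp ?J"
    using log(2) by (simp add: exp_minus field_simps)
  ultimately show ?thesis by blast
qed

section \<open>Rationality\<close>

lemma rational_function_on_const: "rational_function_on D (\<lambda>t. c)"
  unfolding rational_function_on_def
  by (rule exI[of _ "\<lambda>t. c"], rule exI[of _ "\<lambda>t. 1"])
     (auto intro: complex_polynomial_function.intros)

lemma rational_function_on_coord: "rational_function_on D (\<lambda>t. t $ i)"
  unfolding rational_function_on_def
  by (rule exI[of _ "\<lambda>t. t $ i"], rule exI[of _ "\<lambda>t. 1"])
     (auto intro: complex_polynomial_function.intros)

lemma rational_function_on_add:
  assumes "rational_function_on D f" "rational_function_on D g"
  shows "rational_function_on D (\<lambda>t. f t + g t)"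
proof -
  from assms obtain p q p' q' where
    "complex_polynomial_function p" "complex_polynomial_function q"
    "complex_polynomial_function p'" "complex_polynomial_function q'"
    "\<forall>t\<in>D. q t \<noteq> 0 \<and> f t = p t / q t" "\<forall>t\<in>D. q' t \<noteq> 0 \<and> g t = p' t / q' t"
    unfolding rational_function_on_def by blast
  then show ?thesis
    unfolding rational_function_on_def
    by (intro exI[of _ "\<lambda>t. p t * q' t + p' t * q t"] exI[of _ "\<lambda>t. q t * q' t"])
       (auto intro!: complex_polynomial_function.intros simp: add_frac_eq)
qed

lemma rational_function_on_mult:
  assumes "rational_function_on D f" "rational_function_on D g"
  shows "rational_function_on D (\<lambda>t. f t * g t)"
proof -
  from assms obtain p q p' q' where
    "complex_polynomial_function p" "complex_polynomial_function q"
    "complex_polynomial_function p'" "complex_polynomial_function q'"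
    "\<forall>t\<in>D. q t \<noteq> 0 \<and> f t = p t / q t" "\<forall>t\<in>D. q' t \<noteq> 0 \<and> g t = p' t / q' t"
    unfolding rational_function_on_def by blast
  then show ?thesis
    unfolding rational_function_on_def
    by (intro exI[of _ "\<lambda>t. p t * p' t"] exI[of _ "\<lambda>t. q t * q' t"])
       (auto intro!: complex_polynomial_function.intros)
qed

lemma rational_function_on_inverse:
  assumes "rational_function_on D f" "\<And>t. t \<in> D \<Longrightarrow> f t \<noteq> 0"
  shows "rational_function_on D (\<lambda>t. inverse (f t))"
  using assms unfolding rational_function_on_def by (metis div_0 inverse_divide)

lemma rational_function_on_minus:
  assumes "rational_function_on D f"
  shows "rational_function_on D (\<lambda>t. - f t)"
  using rational_function_on_mult[OF rational_function_on_const[of D "- 1"] assms] by simp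

lemma rational_function_on_diff:
  assumes "rational_function_on D f" "rational_function_on D g"
  shows "rational_function_on D (\<lambda>t. f t - g t)"
  using rational_function_on_add[OF assms(1) rational_function_on_minus[OF assms(2)]] by simp

lemma rational_function_on_divide:
  assumes "rational_function_on D f" "rational_function_on D g" "\<And>t. t \<in> D \<Longrightarrow> g t \<noteq> 0"
  shows "rational_function_on D (\<lambda>t. f t / g t)"
  unfolding divide_inverse
  using assms by (intro rational_function_on_mult rational_function_on_inverse)

lemma rational_function_on_sum:
  "(\<And>x. x \<in> X \<Longrightarrow> rational_function_on D (f x)) \<Longrightarrow> rational_function_on D (\<lambda>t. \<Sum>x\<in>X. f x t)"
  by (induction X rule: infinite_finite_induct)
     (auto intro: rational_function_on_const rational_function_on_add)

lemma rational_function_on_prod: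
  "(\<And>x. x \<in> X \<Longrightarrow> rational_function_on D (f x)) \<Longrightarrow> rational_function_on D (\<lambda>t. \<Prod>x\<in>X. f x t)"
  by (induction X rule: infinite_finite_induct)
     (auto intro: rational_function_on_const rational_function_on_mult)

lemma rational_function_on_cong:
  assumes "\<And>t. t \<in> D \<Longrightarrow> f t = g t"
  shows "rational_function_on D f \<longleftrightarrow> rational_function_on D g"
  using assms by (auto simp: rational_function_on_def)

lemma rational_function_on_det:
  assumes "\<And>i j. rational_function_on D (\<lambda>t. M t $ i $ j)"
  shows "rational_function_on D (\<lambda>t. det (M t))"
  unfolding det_def
  by (intro rational_function_on_sum rational_function_on_mult rational_function_on_const
      rational_function_on_prod assms)

lemma rational_function_on_matrix_mult:
  assumes "\<And>i j. rational_function_on D (\<lambda>t. A t $ i $ j)"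
    "\<And>i j. rational_function_on D (\<lambda>t. B t $ i $ j)"
  shows "rational_function_on D (\<lambda>t. (A t ** B t) $ i $ j)"
  unfolding matrix_matrix_mult_def
  by simp (intro rational_function_on_sum rational_function_on_mult assms)

lemma rational_function_on_matrix_inv:
  assumes M: "\<And>i j. rational_function_on D (\<lambda>t. M t $ i $ j)"
    and nz: "\<And>t. t \<in> D \<Longrightarrow> det (M t) \<noteq> 0"
  shows "rational_function_on D (\<lambda>t. matrix_inv (M t) $ i $ j)"
proof -
  have "rational_function_on D (\<lambda>t. (\<chi> r c. if c = i then (if r = j then 1 else 0) else M t $ r $ c) $ r $ c)"
    for r c by (cases "c = i") (auto intro: rational_function_on_const M)
  then have "rational_function_on D
      (\<lambda>t. det (\<chi> r c. if c = i then (if r = j then 1 else 0) else M t $ r $ c) / det (M t))"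
    by (intro rational_function_on_divide rational_function_on_det M nz)
  then show ?thesis
    using rational_function_on_cong[of D] matrix_inv_nth[OF nz] by (metis (no_types, lifting))
qed

lemma rational_function_on_Q_mat:
  "rational_function_on (distinct_coords - Gamma_set F G) (\<lambda>t. Q_mat F G k t $ i $ j)"
proof -
  let ?D = "distinct_coords - Gamma_set F G"
  have nz: "t $ Inl i - t $ Inr j \<noteq> 0" if "t \<in> ?D" for t i j
    using that by (intro distinct_coords_denominator) simp
  have S: "rational_function_on ?D (\<lambda>t. S_mat F G t $ i $ j)" for i j
    unfolding S_mat_nth
    by (intro rational_function_on_divide rational_function_on_const rational_function_on_diff
        rational_function_on_coord nz)
  have dS: "rational_function_on ?D (\<lambda>t. dS F G k t $ i $ j)" for i j
    unfolding dS_def power2_eq_square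
    by (simp, intro rational_function_on_minus rational_function_on_divide rational_function_on_mult
        rational_function_on_const rational_function_on_diff rational_function_on_coord)
      (use nz in auto)
  have T: "rational_function_on ?D (\<lambda>t. S_inv F G t $ i $ j)" for i j
    by (intro rational_function_on_matrix_inv S) (auto simp: Gamma_set_def)
  have "rational_function_on ?D (\<lambda>t. (F ** (S_inv F G t ** dS F G k t ** S_inv F G t) ** G) $ i $ j)"
    by (intro rational_function_on_matrix_mult rational_function_on_const T dS)
  then show ?thesis
    by (subst rational_function_on_cong) (auto simp: Q_mat_eq)
qed

theorem mainTheorem2:
  fixes F :: "complex ^ 'n ^ 'm" and G :: "complex ^ 'm ^ 'n"
  assumes "\<not> frobenius_singular (G ** F)"
  shows
    "((\<forall>k i j. rational_function_on (distinct_coords - Gamma_set F G) (\<lambda>t. Q_mat F G k t $ i $ j)) \<and>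
      (\<forall>t \<in> distinct_coords - Gamma_set F G. \<forall>k.
         (\<forall>l. l \<noteq> k \<longrightarrow>
            has_partial_derivative (Q_mat F G k)
              ((1 / (t $ l - t $ k)) *\<^sub>M commutator (Q_mat F G l t) (Q_mat F G k t)) l t) \<and>
         has_partial_derivative (Q_mat F G k)
           (\<Sum>l \<in> UNIV - {k}.
              (1 / (t $ k - t $ l)) *\<^sub>M commutator (Q_mat F G l t) (Q_mat F G k t)) k t))
     \<and>
     (\<forall>t \<in> distinct_coords - Gamma_set F G. \<forall>k.
        has_partial_derivative (V_mat F G) (Q_mat F G k t) k t)
     \<and>
     (\<forall>t \<in> distinct_coords - Gamma_set F G.
        (\<forall>z. (\<forall>k. z \<noteq> t $ k) \<longrightarrow>
           has_matrix_derivative (\<lambda>w. R_mat F G w t)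
             ((\<Sum>k\<in>UNIV. (1 / (z - t $ k)) *\<^sub>M Q_mat F G k t) ** R_mat F G z t) z) \<and>
        (\<lambda>z. norm (R_mat F G z t - (mat 1 - (1 / z) *\<^sub>M V_mat F G t)))
          \<in> o[at_infinity](\<lambda>z. 1 / cmod z))
     \<and>
     (\<forall>t0 \<in> distinct_coords - Gamma_set F G. \<forall>t \<in> distinct_coords - Gamma_set F G. \<forall>\<gamma>.
        valid_path \<gamma> \<and> path_image \<gamma> \<subseteq> distinct_coords - Gamma_set F G \<and>
        pathstart \<gamma> = t0 \<and> pathfinish \<gamma> = t \<longrightarrow>
        (\<exists>J. has_path_integral
               (\<lambda>i u. \<Sum>j \<in> UNIV - {i}.
                  trace (partial_deriv i (V_mat F G) u ** partial_deriv j (V_mat F G) u)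
                    / (u $ i - u $ j)) J \<gamma> \<and>
             det (S_mat F G t) = det (S_mat F G t0) * exp J))"
proof (intro conjI ballI allI impI)
  fix t :: "complex ^ ('n + 'n)" and k l :: "'n + 'n"
  assume t: "t \<in> distinct_coords - Gamma_set F G" and "l \<noteq> k"
  then have "t $ l - t $ k \<noteq> 0" by (auto simp: distinct_coords_def)
  then have "(1 / (t $ l - t $ k)) *\<^sub>M commutator (Q_mat F G l t) (Q_mat F G k t) = ddV F G k l t"
    by (simp add: commutator_Q_mat[OF t] vec_eq_iff)
  then show "has_partial_derivative (Q_mat F G k)
      ((1 / (t $ l - t $ k)) *\<^sub>M commutator (Q_mat F G l t) (Q_mat F G k t)) l t"
    using has_partial_derivative_Q_mat[OF t] by simp
next
  fix t :: "complex ^ ('n + 'n)" and k :: "'n + 'n"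
  assume t: "t \<in> distinct_coords - Gamma_set F G"
  have "(\<Sum>l \<in> UNIV - {k}. (1 / (t $ k - t $ l)) *\<^sub>M commutator (Q_mat F G l t) (Q_mat F G k t))
      = (\<Sum>l \<in> UNIV - {k}. - ddV F G k l t)"
  proof (intro sum.cong refl)
    fix l assume "l \<in> UNIV - {k}"
    then have "t $ l - t $ k \<noteq> 0" using t by (auto simp: distinct_coords_def)
    then show "(1 / (t $ k - t $ l)) *\<^sub>M commutator (Q_mat F G l t) (Q_mat F G k t)
        = - ddV F G k l t"
      by (simp add: commutator_Q_mat[OF t] vec_eq_iff field_simps)
  qed
  also have "\<dots> = ddV F G k k t"
    using ddV_sum[OF t, of k] by (simp add: sum_negf sum_diff1)
  finally show "has_partial_derivative (Q_mat F G k)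
      (\<Sum>l \<in> UNIV - {k}. (1 / (t $ k - t $ l)) *\<^sub>M commutator (Q_mat F G l t) (Q_mat F G k t)) k t"
    using has_partial_derivative_Q_mat[OF t, of k k] by simp
next
  fix t0 t \<gamma>
  assume "valid_path \<gamma> \<and> path_image \<gamma> \<subseteq> distinct_coords - Gamma_set F G \<and>
        pathstart \<gamma> = t0 \<and> pathfinish \<gamma> = t"
  then show "\<exists>J. has_path_integral
        (\<lambda>i u. \<Sum>j \<in> UNIV - {i}.
           trace (partial_deriv i (V_mat F G) u ** partial_deriv j (V_mat F G) u)
             / (u $ i - u $ j)) J \<gamma> \<and>
      det (S_mat F G t) = det (S_mat F G t0) * exp J"
    using tau_function_along_path[of \<gamma> F G] by (auto simp: pathstart_def pathfinish_def)
qed (simp_all add: rational_function_on_Q_mat has_partial_derivative_V_mat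
    has_matrix_derivative_R_mat R_mat_asymptotics)

end
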